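(* Let $n$ be a positive integer, let $C,q>1$, and let $E$ be an r.i. space on $[0,1]$. If $$\|T_q y\|_E\le C\,\|Uy\|_E$$ for every diagonal $n\times n$ matrix $y$, then $$\|T_q x\|_E\le 7C\left(\|Ux\|_E+\Big(\frac1n\sum_{k=n+1}^{n^2}(x_k^* )^q\Big)^{1/q}\right)$$ for every real $n\times n$ matrix $x$.
   Context: For a measurable $x$ on $[0,1]$, $x^*(t)$ is the decreasing rearrangement of $|x|$. A Banach space $E$ of measurable functions on $[0,1]$ is rearrangement invariant (r.i.) if $y\in E$ and $x^*\le y^*$ imply $x\in E$ and $\|x\|_E\le\|y\|_E$. Standing assumptions: $\|1\|_E=1$, and $E$ is maximal or minimal in the sense of Lindenstrauss and Tzafriri (e.g. $E$ is separable or isometric to the dual of a separable r.i. space); thus for $x\in E$, $x\ge 0$, $\lim_{t\to\infty}\|\min\{x,t\}\|_E=\|x\|_E$, and $\int_0^\tau x^*\le\int_0^\tau y^*$ for all $\tau\in[0,1]$ implies $\|x\|_E\le\|y\|_E$. For a real $n\times n$ matrix $x=(x_{ij})$, $x_1^*\ge x_2^*\ge\dots\ge x_{n^2}^*$ is the decreasing rearrangement of the numbers $|x_{ij}|$. Let $S_n$ be the group of permutations of $\{1,\dots,n\}$ and $\ell:S_n\to\{1,\dots,n!\}$ a bijection. For $1\le q<\infty$ define the step function on $[0,1)$ $$T_qx(t)=\Big(\sum_{i=1}^n|x_{i,\pi(i)}|^q\Big)^{1/q},\qquad t\in\Big[\tfrac{\ell(\pi)-1}{n!},\tfrac{\ell(\pi)}{n!}\Big);$$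 $\|T_qx\|_E$ does not depend on $\ell$. Define also $Ux(t)=\sum_{k=1}^n x_k^*\chi_{((k-1)/n,k/n)}(t)$. *)

theory Defs
  imports "HOL-Analysis.Analysis" "Jordan_Normal_Form.Matrix"
begin

abbreviation M01 :: "real measure" where
  "M01 \<equiv> lebesgue_on {0..1}"

text \<open>The value at 0 is the essential supremum of \<open>\<bar>x\<bar>\<close>, which may be infinite; hence
  the extended range.\<close>

definition decr_rearr :: "(real \<Rightarrow> real) \<Rightarrow> real \<Rightarrow> ennreal" where
  "decr_rearr x t = Inf {s. emeasure M01 {u \<in> {0..1}. ennreal \<bar>x u\<bar> > s} \<le> ennreal t}"

text \<open>A space of (classes of) measurable functions is given by the set \<open>E\<close> of all its
  representatives together with its norm \<open>N\<close>. Values of a function off \<open>{0..1}\<close> and values of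
  \<open>N\<close> off \<open>E\<close> are irrelevant.\<close>

definition banach_function_space :: "(real \<Rightarrow> real) set \<Rightarrow> ((real \<Rightarrow> real) \<Rightarrow> real) \<Rightarrow> bool" where
  "banach_function_space E N \<longleftrightarrow>
     E \<subseteq> borel_measurable M01 \<and>
     (\<lambda>_. 0) \<in> E \<and>
     (\<forall>f\<in>E. \<forall>g\<in>E. (\<lambda>t. f t + g t) \<in> E \<and> N (\<lambda>t. f t + g t) \<le> N f + N g) \<and>
     (\<forall>c. \<forall>f\<in>E. (\<lambda>t. c * f t) \<in> E \<and> N (\<lambda>t. c * f t) = \<bar>c\<bar> * N f) \<and>
     (\<forall>f\<in>E. N f = 0 \<longleftrightarrow> (AE t in M01. f t = 0)) \<and>
     (\<forall>F. (\<forall>k. F k \<in> E) \<and>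
          (\<forall>e>0. \<exists>K. \<forall>i\<ge>K. \<forall>j\<ge>K. N (\<lambda>t. F i t - F j t) < e) \<longrightarrow>
          (\<exists>f\<in>E. (\<lambda>k::nat. N (\<lambda>t. F k t - f t)) \<longlonglongrightarrow> 0))"

definition rearrangement_invariant ::
    "(real \<Rightarrow> real) set \<Rightarrow> ((real \<Rightarrow> real) \<Rightarrow> real) \<Rightarrow> bool" where
  "rearrangement_invariant E N \<longleftrightarrow>
     (\<forall>y\<in>E. \<forall>x\<in>borel_measurable M01.
        (\<forall>t\<in>{0..1}. decr_rearr x t \<le> decr_rearr y t) \<longrightarrow> x \<in> E \<and> N x \<le> N y)"

text \<open>The Koethe dual \<open>E'\<close> with its norm; iterating gives \<open>E''\<close>.\<close>

definition koethe_ennorm ::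
    "(real \<Rightarrow> real) set \<Rightarrow> ((real \<Rightarrow> real) \<Rightarrow> real) \<Rightarrow> (real \<Rightarrow> real) \<Rightarrow> ennreal" where
  "koethe_ennorm E N g = (SUP f\<in>{f \<in> E. N f \<le> 1}. \<integral>\<^sup>+ t. ennreal \<bar>f t * g t\<bar> \<partial>M01)"

definition koethe_dual ::
    "(real \<Rightarrow> real) set \<Rightarrow> ((real \<Rightarrow> real) \<Rightarrow> real) \<Rightarrow> (real \<Rightarrow> real) set" where
  "koethe_dual E N = {g \<in> borel_measurable M01. koethe_ennorm E N g < \<infinity>}"

definition koethe_norm ::
    "(real \<Rightarrow> real) set \<Rightarrow> ((real \<Rightarrow> real) \<Rightarrow> real) \<Rightarrow> (real \<Rightarrow> real) \<Rightarrow> real" where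
  "koethe_norm E N g = enn2real (koethe_ennorm E N g)"

definition koethe_bidual ::
    "(real \<Rightarrow> real) set \<Rightarrow> ((real \<Rightarrow> real) \<Rightarrow> real) \<Rightarrow> (real \<Rightarrow> real) set" where
  "koethe_bidual E N = koethe_dual (koethe_dual E N) (koethe_norm E N)"

definition koethe_binorm ::
    "(real \<Rightarrow> real) set \<Rightarrow> ((real \<Rightarrow> real) \<Rightarrow> real) \<Rightarrow> (real \<Rightarrow> real) \<Rightarrow> real" where
  "koethe_binorm E N = koethe_norm (koethe_dual E N) (koethe_norm E N)"

text \<open>Lindenstrauss and Tzafriri, Classical Banach Spaces II, Definition 2.a.1: \<open>E\<close> is
  isometrically a subspace of \<open>E''\<close>, and is either all of \<open>E''\<close> or the closure in \<open>E''\<close> of the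
  simple functions.\<close>

definition maximal_space :: "(real \<Rightarrow> real) set \<Rightarrow> ((real \<Rightarrow> real) \<Rightarrow> real) \<Rightarrow> bool" where
  "maximal_space E N \<longleftrightarrow>
     (\<forall>f\<in>E. N f = koethe_binorm E N f) \<and> E = koethe_bidual E N"

definition minimal_space :: "(real \<Rightarrow> real) set \<Rightarrow> ((real \<Rightarrow> real) \<Rightarrow> real) \<Rightarrow> bool" where
  "minimal_space E N \<longleftrightarrow>
     (\<forall>f\<in>E. N f = koethe_binorm E N f) \<and>
     E = {f \<in> koethe_bidual E N. \<forall>e>0. \<exists>s\<in>koethe_bidual E N.
            simple_function M01 s \<and> koethe_binorm E N (\<lambda>t. f t - s t) < e}"

definition ri_space :: "(real \<Rightarrow> real) set \<Rightarrow> ((real \<Rightarrow> real) \<Rightarrow> real) \<Rightarrow> bool" where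
  "ri_space E N \<longleftrightarrow>
     banach_function_space E N \<and> rearrangement_invariant E N \<and>
     (\<lambda>_. 1) \<in> E \<and> N (\<lambda>_. 1) = 1 \<and>
     (maximal_space E N \<or> minimal_space E N)"

text \<open>The index \<open>k\<close> starts at 1; rows and columns of a matrix are numbered from 0.\<close>

definition mat_rearr :: "real mat \<Rightarrow> nat \<Rightarrow> real" where
  "mat_rearr x k =
     rev (sort [\<bar>x $$ (i, j)\<bar>. i \<leftarrow> [0..<dim_row x], j \<leftarrow> [0..<dim_col x]]) ! (k - 1)"

definition T_op :: "((nat \<Rightarrow> nat) \<Rightarrow> nat) \<Rightarrow> real \<Rightarrow> real mat \<Rightarrow> real \<Rightarrow> real" where
  "T_op l q x t =
     (let n = dim_row x in
      \<Sum>p | p permutes {..<n}.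
        (\<Sum>i<n. \<bar>x $$ (i, p i)\<bar> powr q) powr (1 / q) *
        indicator {(real (l p) - 1) / fact n ..< real (l p) / fact n} t)"

definition U_op :: "real mat \<Rightarrow> real \<Rightarrow> real" where
  "U_op x t =
     (let n = dim_row x in
      \<Sum>k = 1..n. mat_rearr x k * indicator {(real k - 1) / real n <..< real k / real n} t)"

end

theory Submission
  imports Defs
begin

text \<open>
  Only step functions with \<open>n!\<close> equal steps occur, and on these \<open>N\<close> is a symmetric norm that
  respects domination of distribution functions; a factor 3 between the distribution functions
  costs a factor 3 in the norm.

  A matrix with at most \<open>n\<close> nonzero entries is compared with the diagonal matrix carrying the same
  entries. A random permutation hits exactly a given set \<open>S\<close> of cells with probability at most
  \<open>(n - card S)!/n!\<close>, and has exactly \<open>S\<close> as its set of fixed points with probability at least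
  \<open>1/3\<close> of this, unless \<open>card S = n - 1\<close>; that case is charged to the identity permutation. Hence
  the \<open>n\<close> largest entries contribute at most \<open>3 C \<parallel>Ux\<parallel>\<close>.

  The remaining entries are cut, in decreasing order, into blocks of \<open>n\<close> cells, and each is
  replaced by the maximum of its block. The \<open>q\<close>-th power of the result is a positive combination of
  hit counts, whose total weight is at most \<open>(x\<^sub>n\<^sup>*)\<^sup>q\<close> plus the average appearing in the theorem. The
  normalised combination has, up to rounding, a distribution function at most 3 times that of the
  number of fixed points, which is the \<open>q\<close>-th power of \<open>T\<^sub>q\<close> of the identity matrix. This
  contributes at most \<open>3 C + 1 \<le> 4 C\<close> times the right-hand bracket.
\<close>

subsection \<open>Permutations hitting a board of \<open>n\<close> cells\<close>

text \<open>Count the pairs of a \<open>p\<close> and a \<open>k\<close>-subset of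
  \<open>H p\<close> in both orders. For hit sets this evaluates a binomial moment of the number of
  hits.\<close>

lemma sum_choose_card_eq:
  fixes H :: "'p \<Rightarrow> 'a set"
  assumes "finite P" "finite I" "\<And>p. p \<in> P \<Longrightarrow> H p \<subseteq> I"
  shows "(\<Sum>p\<in>P. card (H p) choose k) = (\<Sum>S | S \<subseteq> I \<and> card S = k. card {p \<in> P. S \<subseteq> H p})"
proof -
  have fin: "finite {S. S \<subseteq> I \<and> card S = k}"
    using assms(2) by simp
  have "card (H p) choose k = (\<Sum>S | S \<subseteq> I \<and> card S = k. of_bool (S \<subseteq> H p))" if "p \<in> P" for p
  proof -
    have "finite (H p)"
      using assms that finite_subset by blast
    then have "card (H p) choose k = card {S. S \<subseteq> H p \<and> card S = k}"
      by (simp add: n_subsets)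
    also have "{S. S \<subseteq> H p \<and> card S = k} = {S. S \<subseteq> I \<and> card S = k} \<inter> {S. S \<subseteq> H p}"
      using assms(3)[OF that] by auto
    finally show ?thesis
      using fin by simp
  qed
  then have "(\<Sum>p\<in>P. card (H p) choose k)
      = (\<Sum>p\<in>P. \<Sum>S | S \<subseteq> I \<and> card S = k. of_bool (S \<subseteq> H p))"
    by simp
  also have "\<dots> = (\<Sum>S | S \<subseteq> I \<and> card S = k. \<Sum>p\<in>P. of_bool (S \<subseteq> H p))"
    by (rule sum.swap)
  also have "\<dots> = (\<Sum>S | S \<subseteq> I \<and> card S = k. card {p \<in> P. S \<subseteq> H p})"
    using assms(1) by (simp add: Collect_conj_eq)
  finally show ?thesis .
qed

text \<open>By Pascal's rule a unit step in \<open>m\<close> raises the right side by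
  \<open>m choose (k - 1)\<close>, which is at least 1 once \<open>k \<le> Suc m\<close>. This
  bounds the excess of a hit count over \<open>k - 1\<close> by a term whose sum over permutations
  is a binomial moment.\<close>

lemma Suc_diff_le_choose: "k \<ge> 1 \<Longrightarrow> Suc m - k \<le> m choose k"
proof (induction m)
  case (Suc m)
  show ?case
  proof (cases "k \<le> Suc m")
    case True
    then have "m choose (k - 1) \<ge> 1"
      by (simp add: Suc_leI)
    moreover have "Suc m choose k = (m choose (k - 1)) + (m choose k)"
      using Suc.prems by (cases k) auto
    ultimately show ?thesis
      using Suc by linarith
  qed simp
qed simp

text \<open>Inclusion-exclusion stopped after the cubic term:
  \<open>1 - m + (m choose 2) - (m choose 3)\<close> is at most the indicator of
  \<open>m = 0\<close>. Negative terms are moved across to stay within the natural numbers.\<close>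

lemma bonferroni_three:
  "1 + (m choose 2) \<le> of_bool (m = 0) + m + (m choose 3)"
proof -
  have *: "m \<le> 1 + (m choose 2)" for m
    using Suc_diff_le_choose[of 2 m] by linarith
  show ?thesis
  proof (induction m)
    case (Suc m)
    have "Suc m choose 2 = m + (m choose 2)" "Suc m choose 3 = (m choose 2) + (m choose 3)"
      by (simp_all add: numeral_eq_Suc)
    then show ?case
      using Suc *[of m] by (cases "m = 0") auto
  qed (simp add: numeral_eq_Suc)
qed

section \<open>Permutations with prescribed fixed points, and derangements\<close>

lemma permutes_fixing_eq:
  "S \<subseteq> A \<Longrightarrow> {p. p permutes A \<and> (\<forall>i\<in>S. p i = i)} = {p. p permutes (A - S)}"
  by (auto simp: permutes_def)

text \<open>Sum \<open>bonferroni_three\<close> over all permutations, with \<open>m\<close> the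
  number of fixed points. For \<open>k \<le> card A\<close> the \<open>k\<close>-th binomial moment
  is \<open>fact (card A) / fact k\<close>, and \<open>1 - 1 + 1/2 - 1/6 = 1/3\<close>. A
  one-element set has no derangement.\<close>

lemma fact_le_three_times_derangements:
  assumes "finite A" "card A \<noteq> 1"
  shows "fact (card A) \<le> 3 * card {p. p permutes A \<and> (\<forall>i\<in>A. p i \<noteq> i)}"
proof -
  define P where "P = {p. p permutes A}"
  define F where "F = (\<lambda>p. {i \<in> A. p i = i})"
  define m where "m = card A"
  have fP: "finite P"
    using assms by (simp add: P_def finite_permutations)
  have cP: "card P = fact m"
    using assms by (simp add: P_def m_def card_permutations)
  have fixed: "(\<Sum>p\<in>P. card (F p) choose k) = (m choose k) * fact (m - k)" for k
  proof -
    have "card {p \<in> P. S \<subseteq> F p} = fact (m - k)" if "S \<subseteq> A" "card S = k" for S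
    proof -
      have "{p \<in> P. S \<subseteq> F p} = {p. p permutes (A - S)}"
        using permutes_fixing_eq[OF that(1)] that(1) by (auto simp: P_def F_def)
      then show ?thesis
        using that assms(1) by (simp add: card_permutations card_Diff_subset finite_subset m_def)
    qed
    then show ?thesis
      using sum_choose_card_eq[OF fP assms(1), of F k] assms(1)
      by (simp add: F_def n_subsets m_def)
  qed
  have D: "{p. p permutes A \<and> (\<forall>i\<in>A. p i \<noteq> i)} = {p\<in>P. card (F p) = 0}"
    using assms(1) by (auto simp: P_def F_def)
  have "(\<Sum>p\<in>P. 1 + (card (F p) choose 2))
      \<le> (\<Sum>p\<in>P. of_bool (card (F p) = 0) + (card (F p) choose 1) + (card (F p) choose 3))"
    by (intro sum_mono) (use bonferroni_three in auto)
  then have main: "fact m + (m choose 2) * fact (m - 2)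
      \<le> card {p\<in>P. card (F p) = 0} + m * fact (m - 1) + (m choose 3) * fact (m - 3)"
    unfolding sum.distrib fixed using fP cP by (simp add: Collect_conj_eq)
  have "fact m \<le> 3 * card {p\<in>P. card (F p) = 0}"
  proof (cases "m = 0")
    case True
    then show ?thesis
      using main by (simp add: numeral_eq_Suc)
  next
    case False
    then have "m \<ge> 2"
      using assms(2) m_def by simp
    have c2: "2 * ((m choose 2) * fact (m - 2)) = fact m"
      using binomial_fact_lemma[OF \<open>m \<ge> 2\<close>] by (simp add: ac_simps)
    have c1: "m * fact (m - 1) = fact m"
      using False by (simp add: fact_reduce)
    \<comment> \<open>Only an inequality, because the third moment vanishes for
      \<open>m = 2\<close>.\<close>
    have c3: "6 * ((m choose 3) * fact (m - 3)) \<le> fact m"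
    proof (cases "m = 2")
      case False
      then have "fact 3 * fact (m - 3) * (m choose 3) = fact m"
        using \<open>m \<ge> 2\<close> by (intro binomial_fact_lemma) simp
      then show ?thesis
        by (simp add: ac_simps fact_numeral)
    qed (simp add: numeral_eq_Suc)
    show ?thesis
      using main c1 c2 c3 by linarith
  qed
  then show ?thesis
    by (simp add: D m_def)
qed

section \<open>Boards and the sets of their cells hit by a permutation\<close>

definition hits :: "nat \<Rightarrow> (nat \<Rightarrow> nat \<times> nat) \<Rightarrow> (nat \<Rightarrow> nat) \<Rightarrow> nat set" where
  "hits n c p = {k \<in> {..<n}. p (fst (c k)) = snd (c k)}"

text \<open>The cells are enumerated rather than collected in a set: hit sets of different boards
  are then all subsets of \<open>{..<n}\<close> and can be compared with each other, in particular
  with those of the diagonal.\<close>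

definition board :: "nat \<Rightarrow> (nat \<Rightarrow> nat \<times> nat) \<Rightarrow> bool" where
  "board n c \<longleftrightarrow> inj_on c {..<n} \<and> c ` {..<n} \<subseteq> {..<n} \<times> {..<n}"

abbreviation (input) perms :: "nat \<Rightarrow> (nat \<Rightarrow> nat) set" where
  "perms n \<equiv> {p. p permutes {..<n}}"

abbreviation (input) fixpts :: "nat \<Rightarrow> (nat \<Rightarrow> nat) \<Rightarrow> nat set" where
  "fixpts n \<equiv> hits n (\<lambda>k. (k, k))"

lemma hits_subset: "hits n c p \<subseteq> {..<n}"
  by (auto simp: hits_def)

lemma finite_hits [simp]: "finite (hits n c p)"
  by (simp add: hits_def)

lemma card_hits_le: "card (hits n c p) \<le> n"
  using card_mono[OF _ hits_subset] by fastforce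

lemma finite_perms [simp]: "finite (perms n)"
  by (simp add: finite_permutations)

lemma card_perms [simp]: "card (perms n) = fact n"
  by (simp add: card_permutations)

lemma board_cellD:
  "board n c \<Longrightarrow> k < n \<Longrightarrow> fst (c k) < n \<and> snd (c k) < n"
  unfolding board_def by (auto simp: image_subset_iff mem_Times_iff)

text \<open>If \<open>p0\<close> is one such permutation, composition with its inverse maps all of
  them injectively to permutations that fix \<open>R\<close> pointwise.\<close>

lemma card_perms_agreeing_le:
  assumes "R \<subseteq> {..<n}"
  shows "card {p \<in> perms n. \<forall>i\<in>R. p i = f i} \<le> fact (n - card R)"
proof (cases "\<exists>p0\<in>perms n. \<forall>i\<in>R. p0 i = f i")
  case True
  then obtain p0 where p0: "p0 permutes {..<n}" "\<forall>i\<in>R. p0 i = f i"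
    by auto
  let ?Q = "{p \<in> perms n. \<forall>i\<in>R. p i = f i}"
  let ?g = "inv_into UNIV p0"
  have "inj_on ((\<circ>) ?g) ?Q"
  proof (rule inj_onI)
    fix p p' assume "?g \<circ> p = ?g \<circ> p'"
    then have "p0 \<circ> ?g \<circ> p = p0 \<circ> ?g \<circ> p'"
      by (simp add: comp_assoc)
    then show "p = p'"
      by (simp add: permutes_inv_o(1)[OF p0(1)])
  qed
  moreover have "(\<circ>) ?g ` ?Q \<subseteq> {p. p permutes ({..<n} - R)}"
  proof safe
    fix p assume p: "p permutes {..<n}" "\<forall>i\<in>R. p i = f i"
    have "(?g \<circ> p) permutes {..<n}"
      using p(1) p0(1) by (intro permutes_compose permutes_inv)
    moreover have "\<forall>i\<in>R. (?g \<circ> p) i = i"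
      using p(2) p0 by (metis comp_apply permutes_inverses(2))
    ultimately show "(?g \<circ> p) permutes ({..<n} - R)"
      using permutes_fixing_eq[OF assms] by blast
  qed
  ultimately have "card ?Q \<le> card {p. p permutes ({..<n} - R)}"
    by (intro card_inj_on_le) (auto simp: finite_permutations)
  also have "\<dots> = fact (n - card R)"
    using assms by (simp add: card_permutations card_Diff_subset finite_subset[OF assms])
  finally show ?thesis .
next
  case False
  then have "{p \<in> perms n. \<forall>i\<in>R. p i = f i} = {}"
    by auto
  then show ?thesis
    by (metis card.empty zero_le)
qed

lemma board_eq_row:
  assumes "board n c" "j \<in> hits n c p" "k \<in> hits n c p" "fst (c j) = fst (c k)"
  shows "j = k"
  using assms by (auto simp: hits_def board_def inj_on_def prod_eq_iff)

lemma board_eq_col: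
  assumes "board n c" "p permutes {..<n}" "j \<in> hits n c p" "k \<in> hits n c p" "snd (c j) = snd (c k)"
  shows "j = k"
proof -
  have "p (fst (c j)) = p (fst (c k))"
    using assms by (simp add: hits_def)
  then have "fst (c j) = fst (c k)"
    using assms(2) by (metis permutes_inverses(2))
  then show ?thesis
    using assms board_eq_row by blast
qed

text \<open>If the cells of \<open>S\<close> lie in distinct rows, hitting them prescribes the
  permutation on \<open>card S\<close> rows. If two of them share a row, no permutation hits
  both.\<close>

lemma card_hits_superset_le:
  assumes "board n c" "S \<subseteq> {..<n}"
  shows "card {p \<in> perms n. S \<subseteq> hits n c p} \<le> fact (n - card S)"
proof (cases "inj_on (fst \<circ> c) S")
  case True
  define R where "R = (fst \<circ> c) ` S"
  define f where "f = (\<lambda>i. snd (c (inv_into S (fst \<circ> c) i)))"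
  have f: "f (fst (c k)) = snd (c k)" if "k \<in> S" for k
    using inv_into_f_f[OF True that] by (simp add: f_def)
  have "{p \<in> perms n. S \<subseteq> hits n c p} = {p \<in> perms n. \<forall>i\<in>R. p i = f i}"
    using assms(2) f by (auto simp: R_def hits_def)
  moreover have "R \<subseteq> {..<n}"
    using assms board_cellD by (auto simp: R_def)
  moreover have "card R = card S"
    unfolding R_def using True by (rule card_image)
  ultimately show ?thesis
    using card_perms_agreeing_le[of R n f] by simp
next
  case False
  then obtain j k where "j \<in> S" "k \<in> S" "fst (c j) = fst (c k)" "j \<noteq> k"
    by (auto simp: inj_on_def)
  then have "{p \<in> perms n. S \<subseteq> hits n c p} = {}"
    using board_eq_row[OF assms(1)] by blast
  then show ?thesis
    by (metis card.empty zero_le)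
qed

text \<open>The permutations counted on the right are the derangements of the complement of
  \<open>S\<close>. The excluded case is genuine: a permutation fixing all points but one fixes that
  one too.\<close>

lemma fact_le_three_times_card_fixpts_eq:
  assumes "S \<subseteq> {..<n}" "n - card S \<noteq> 1"
  shows "fact (n - card S) \<le> 3 * card {p \<in> perms n. fixpts n p = S}"
proof -
  have eq: "p permutes ({..<n} - S) \<longleftrightarrow> p permutes {..<n} \<and> (\<forall>i\<in>S. p i = i)" for p
    using permutes_fixing_eq[OF assms(1)] by blast
  have "{p \<in> perms n. fixpts n p = S}
      = {p. p permutes ({..<n} - S) \<and> (\<forall>i\<in>{..<n} - S. p i \<noteq> i)}"
    unfolding eq using assms(1) by (auto simp: hits_def)
  moreover have "card ({..<n} - S) = n - card S"
    using assms(1) by (simp add: card_Diff_subset finite_subset[OF assms(1)])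
  ultimately show ?thesis
    using fact_le_three_times_derangements[of "{..<n} - S"] assms(2) by simp
qed

lemma card_perms_hits_eq_le:
  assumes "board n c" "S \<subseteq> {..<n}" "n - card S \<noteq> 1"
  shows "card {p \<in> perms n. hits n c p = S} \<le> 3 * card {p \<in> perms n. fixpts n p = S}"
proof -
  have "card {p \<in> perms n. hits n c p = S} \<le> card {p \<in> perms n. S \<subseteq> hits n c p}"
    by (intro card_mono) auto
  also have "\<dots> \<le> fact (n - card S)"
    using assms card_hits_superset_le by blast
  also have "\<dots> \<le> 3 * card {p \<in> perms n. fixpts n p = S}"
    using assms fact_le_three_times_card_fixpts_eq by blast
  finally show ?thesis .
qed

text \<open>Cells hit in common lie in distinct rows, on which the two permutations agree; a
  permutation is determined by its values on all rows but one.\<close>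

lemma board_common_hits_imp_eq:
  assumes "board n c" "p permutes {..<n}" "p' permutes {..<n}"
    and "n \<le> Suc (card (hits n c p \<inter> hits n c p'))"
  shows "p = p'"
proof -
  let ?K = "hits n c p \<inter> hits n c p'"
  define R where "R = (fst \<circ> c) ` ?K"
  have "inj_on (fst \<circ> c) ?K"
    using board_eq_row[OF assms(1)] by (auto simp: inj_on_def)
  then have "card R = card ?K"
    unfolding R_def by (rule card_image)
  then have "n - card R \<le> 1"
    using assms(4) by linarith
  \<comment> \<open>The difference is 0 or 1, and both factorials are 1.\<close>
  then have "fact (n - card R) = (1::nat)"
    by (auto simp: le_Suc_eq)
  moreover have "R \<subseteq> {..<n}"
    using board_cellD[OF assms(1)] by (auto simp: R_def hits_def)
  ultimately have "card {q \<in> perms n. \<forall>i\<in>R. q i = p i} \<le> 1"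
    using card_perms_agreeing_le[of R n p] by simp
  moreover have "{p, p'} \<subseteq> {q \<in> perms n. \<forall>i\<in>R. q i = p i}"
    using assms(2,3) by (auto simp: R_def hits_def)
  ultimately have "card {p, p'} \<le> 1"
    using card_mono[of "{q \<in> perms n. \<forall>i\<in>R. q i = p i}" "{p, p'}"] by simp
  then show ?thesis
    by (cases "p = p'") auto
qed

text \<open>Each permutation misses at most one cell, but as they differ, together they miss at
  least two. So each misses exactly one, and not the same one.\<close>

lemma board_missed_cells:
  assumes "board n c" "p permutes {..<n}" "p' permutes {..<n}" "p \<noteq> p'"
    and "n - 1 \<le> card (hits n c p)" "n - 1 \<le> card (hits n c p')"
  obtains a b where "{..<n} - hits n c p = {a}" "{..<n} - hits n c p' = {b}" "a \<noteq> b"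
proof -
  let ?M = "{..<n} - hits n c p" and ?M' = "{..<n} - hits n c p'"
  have le: "card ?M \<le> 1" "card ?M' \<le> 1"
    using assms(5,6) by (simp_all add: card_Diff_subset hits_subset)
  have two: "2 \<le> card (?M \<union> ?M')"
  proof -
    have "?M \<union> ?M' = {..<n} - (hits n c p \<inter> hits n c p')"
      by blast
    moreover have "hits n c p \<inter> hits n c p' \<subseteq> {..<n}"
      using hits_subset by blast
    ultimately have "card (?M \<union> ?M') = n - card (hits n c p \<inter> hits n c p')"
      by (simp add: card_Diff_subset)
    moreover have "Suc (card (hits n c p \<inter> hits n c p')) < n"
      using board_common_hits_imp_eq assms(1-4) by (meson not_less)
    ultimately show ?thesis
      by linarith
  qed
  have un: "card (?M \<union> ?M') \<le> card ?M + card ?M'"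
    by (rule card_Un_le)
  have "card ?M = 1" "card ?M' = 1"
    using le two un by linarith+
  then obtain a b where ab: "?M = {a}" "?M' = {b}"
    by (elim card_1_singletonE)
  moreover have "a \<noteq> b"
    using two unfolding ab by auto
  ultimately show ?thesis
    using that by blast
qed

lemma card_perms_all_hit_le:
  assumes "board n c"
  shows "card {p \<in> perms n. n \<le> card (hits n c p)} \<le> 1"
proof -
  have "p = p'" if "p \<in> perms n" "p' \<in> perms n" "n \<le> card (hits n c p)" "n \<le> card (hits n c p')" for p p'
  proof -
    have "hits n c p = {..<n}" "hits n c p' = {..<n}"
      using that hits_subset by (metis card_lessThan card_seteq finite_lessThan)+
    then show ?thesis
      using board_common_hits_imp_eq[OF assms] that by simp
  qed
  then show ?thesis
    by (auto simp: card_le_Suc0_iff_eq)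
qed

text \<open>Three such permutations would miss three different cells. This forces the cells to have
  distinct rows and distinct columns, so that the board is the graph of a permutation. One of the
  three agrees with it in all rows but one, hence in all, and misses nothing.\<close>

lemma card_perms_near_full_le:
  assumes "board n c"
  shows "card {p \<in> perms n. n - 1 \<le> card (hits n c p)} \<le> 2"
proof (rule ccontr)
  let ?Q = "{p \<in> perms n. n - 1 \<le> card (hits n c p)}"
  assume "\<not> card ?Q \<le> 2"
  then obtain T where "T \<subseteq> ?Q" "card T = 3"
    using obtain_subset_with_card_n[of 3 ?Q] by auto
  then obtain p1 p2 p3 where p: "p1 \<in> ?Q" "p2 \<in> ?Q" "p3 \<in> ?Q"
    and ne: "p1 \<noteq> p2" "p1 \<noteq> p3" "p2 \<noteq> p3"
    by (auto simp: card_3_iff)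
  obtain a1 a2 where a12: "{..<n} - hits n c p1 = {a1}" "{..<n} - hits n c p2 = {a2}" "a1 \<noteq> a2"
    using board_missed_cells[OF assms, of p1 p2] p ne by blast
  obtain b1 a3 where b13: "{..<n} - hits n c p1 = {b1}" "{..<n} - hits n c p3 = {a3}" "b1 \<noteq> a3"
    using board_missed_cells[OF assms, of p1 p3] p ne by blast
  obtain b2 b3 where b23: "{..<n} - hits n c p2 = {b2}" "{..<n} - hits n c p3 = {b3}" "b2 \<noteq> b3"
    using board_missed_cells[OF assms, of p2 p3] p ne by blast
  have a: "a1 \<noteq> a2" "a1 \<noteq> a3" "a2 \<noteq> a3"
    using a12 b13 b23 by auto
  have hit: "k \<in> hits n c p1 \<longleftrightarrow> k \<noteq> a1" "k \<in> hits n c p2 \<longleftrightarrow> k \<noteq> a2" "k \<in> hits n c p3 \<longleftrightarrow> k \<noteq> a3"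
    if "k < n" for k
    using that a12 b13(2) by blast+
  \<comment> \<open>Each of the two cells is missed by at most one of the three permutations, so one
    permutation hits both.\<close>
  have both: "\<exists>q\<in>{p1, p2, p3}. j \<in> hits n c q \<and> k \<in> hits n c q" if "j < n" "k < n" for j k
    using hit[OF that(1)] hit[OF that(2)] a by auto
  have row: "inj_on (fst \<circ> c) {..<n}"
    using both board_eq_row[OF assms] unfolding inj_on_def by (metis comp_apply lessThan_iff)
  have col: "inj_on (snd \<circ> c) {..<n}"
  proof (rule inj_onI)
    fix j k assume jk: "j \<in> {..<n}" "k \<in> {..<n}" "(snd \<circ> c) j = (snd \<circ> c) k"
    then obtain q where "q \<in> {p1, p2, p3}" "j \<in> hits n c q" "k \<in> hits n c q"
      using both by auto
    then show "j = k"
      using board_eq_col[OF assms, of q j k] p jk(3) by auto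
  qed
  \<comment> \<open>All columns occur on the board, so the column that \<open>p1\<close> assigns to
    the row of the missed cell \<open>a1\<close> belongs to another cell \<open>m\<close>. As
    \<open>p1\<close> hits \<open>m\<close>, injectivity puts \<open>m\<close> and \<open>a1\<close>
    in the same row.\<close>
  have "(snd \<circ> c) ` {..<n} = {..<n}"
    using col board_cellD[OF assms] by (intro endo_inj_surj) auto
  moreover have a1: "a1 < n" "a1 \<notin> hits n c p1"
    using a12(1) by auto
  moreover have "p1 (fst (c a1)) < n"
    using board_cellD[OF assms a1(1)] p(1) permutes_in_image[of p1 "{..<n}"] by auto
  ultimately obtain m where m: "m < n" "snd (c m) = p1 (fst (c a1))"
    by (metis (no_types, lifting) comp_apply imageE lessThan_iff)
  then have "m \<noteq> a1"
    using a1 by (auto simp: hits_def)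
  then have "p1 (fst (c m)) = snd (c m)"
    using hit(1)[OF m(1)] by (simp add: hits_def)
  then have "fst (c m) = fst (c a1)"
    using m(2) p(1) by (metis (no_types, lifting) mem_Collect_eq permutes_inverses(2))
  then show False
    using row m(1) a1(1) \<open>m \<noteq> a1\<close> by (auto simp: inj_on_def)
qed

section \<open>Comparison of hits with fixed points\<close>

lemma card_perms_hits_in_le:
  assumes "board n c" and "\<And>S. S \<in> \<S> \<Longrightarrow> S \<subseteq> {..<n} \<and> n - card S \<noteq> 1"
  shows "card {p \<in> perms n. hits n c p \<in> \<S>} \<le> 3 * card {p \<in> perms n. fixpts n p \<in> \<S>}"
proof -
  have fin: "finite \<S>"
    using assms(2) by (intro finite_subset[of \<S> "Pow {..<n}"]) auto
  have split: "card {p \<in> perms n. H p \<in> \<S>} = (\<Sum>S\<in>\<S>. card {p \<in> perms n. H p = S})"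
    for H :: "(nat \<Rightarrow> nat) \<Rightarrow> nat set"
  proof -
    have "{p \<in> perms n. H p \<in> \<S>} = (\<Union>S\<in>\<S>. {p \<in> perms n. H p = S})"
      by auto
    then show ?thesis
      using fin by (simp add: card_UN_disjoint disjoint_iff)
  qed
  show ?thesis
    unfolding split sum_distrib_left
    using assms card_perms_hits_eq_le by (intro sum_mono) blast
qed

lemma fixpts_id [simp]: "fixpts n id = {..<n}"
  by (auto simp: hits_def)

text \<open>Hit sets of size below \<open>n - 1\<close> are compared one by one. At most two
  permutations have larger hit sets; if one of these sets satisfies \<open>Q\<close>, then so does
  \<open>{..<n}\<close>, and the identity supplies one permutation on the right, counted three
  times.\<close>

lemma card_perms_hits_upclosed_le:
  assumes "board n c" and up: "\<And>S T. Q S \<Longrightarrow> S \<subseteq> T \<Longrightarrow> T \<subseteq> {..<n} \<Longrightarrow> Q T"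
  shows "card {p \<in> perms n. Q (hits n c p)} \<le> 3 * card {p \<in> perms n. Q (fixpts n p)}"
proof -
  define \<S> where "\<S> = {S. S \<subseteq> {..<n} \<and> Suc (card S) < n \<and> Q S}"
  define X where "X = {p \<in> perms n. n - 1 \<le> card (hits n c p) \<and> Q (hits n c p)}"
  define Y where "Y = {p \<in> perms n. n - 1 \<le> card (fixpts n p) \<and> Q (fixpts n p)}"
  have split: "card {p \<in> perms n. Q (hits n d p)} = card {p \<in> perms n. hits n d p \<in> \<S>}
      + card {p \<in> perms n. n - 1 \<le> card (hits n d p) \<and> Q (hits n d p)}" for d
  proof -
    have "{p \<in> perms n. Q (hits n d p)} = {p \<in> perms n. hits n d p \<in> \<S>}
        \<union> {p \<in> perms n. n - 1 \<le> card (hits n d p) \<and> Q (hits n d p)}"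
      using hits_subset by (auto simp: \<S>_def)
    moreover have "{p \<in> perms n. hits n d p \<in> \<S>}
        \<inter> {p \<in> perms n. n - 1 \<le> card (hits n d p) \<and> Q (hits n d p)} = {}"
      by (auto simp: \<S>_def)
    ultimately show ?thesis
      by (simp add: card_Un_disjoint)
  qed
  have "card X \<le> 3 * card Y"
  proof (cases "X = {}")
    case False
    then have "Q {..<n}"
      using up hits_subset by (auto simp: X_def)
    then have "id \<in> Y"
      by (simp add: Y_def permutes_id)
    then have "card Y \<ge> 1"
      using card_mono[of Y "{id}"] by (simp add: Y_def)
    moreover have "card X \<le> card {p \<in> perms n. n - 1 \<le> card (hits n c p)}"
      unfolding X_def by (intro card_mono) auto
    ultimately show ?thesis
      using card_perms_near_full_le[OF assms(1)] by linarith
  qed simp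
  moreover have "card {p \<in> perms n. hits n c p \<in> \<S>} \<le> 3 * card {p \<in> perms n. fixpts n p \<in> \<S>}"
    using assms(1) by (intro card_perms_hits_in_le) (auto simp: \<S>_def)
  ultimately show ?thesis
    unfolding split X_def Y_def by simp
qed

text \<open>For \<open>k \<noteq> n - 1\<close> the excess is bounded by a binomial moment, and each
  \<open>k\<close>-set \<open>S\<close> contributes at most three times the number of permutations
  with fixed point set exactly \<open>S\<close>. For \<open>k = n - 1\<close> the excess is at most
  the sum of two indicators, with counts at most 2 and 1, and three copies of the identity pay for
  both.\<close>

lemma sum_excess_hits_le:
  assumes "board n c" "k \<ge> 1"
  shows "(\<Sum>p\<in>perms n. Suc (card (hits n c p)) - k) \<le> 3 * card {p \<in> perms n. k \<le> card (fixpts n p)}"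
proof (cases "n - k = 1")
  case True
  have "(\<Sum>p\<in>perms n. Suc (card (hits n c p)) - k)
      \<le> (\<Sum>p\<in>perms n. of_bool (n - 1 \<le> card (hits n c p)) + of_bool (n \<le> card (hits n c p)))"
  proof (intro sum_mono)
    fix p
    show "Suc (card (hits n c p)) - k
        \<le> of_bool (n - 1 \<le> card (hits n c p)) + of_bool (n \<le> card (hits n c p))"
      using True card_hits_le[of n c p] by auto
  qed
  also have "\<dots> = card {p \<in> perms n. n - 1 \<le> card (hits n c p)} + card {p \<in> perms n. n \<le> card (hits n c p)}"
    by (simp add: sum.distrib Collect_conj_eq)
  also have "\<dots> \<le> 3 * 1"
    using card_perms_near_full_le[OF assms(1)] card_perms_all_hit_le[OF assms(1)] by linarith
  also have "\<dots> \<le> 3 * card {p \<in> perms n. k \<le> card (fixpts n p)}"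
  proof -
    have "id \<in> {p \<in> perms n. k \<le> card (fixpts n p)}"
      using True by (simp add: permutes_id)
    then show ?thesis
      using card_mono[of "{p \<in> perms n. k \<le> card (fixpts n p)}" "{id}"] by simp
  qed
  finally show ?thesis .
next
  case False
  let ?\<S> = "{S. S \<subseteq> {..<n} \<and> card S = k}"
  have "(\<Sum>p\<in>perms n. Suc (card (hits n c p)) - k) \<le> (\<Sum>p\<in>perms n. card (hits n c p) choose k)"
    using assms(2) by (intro sum_mono Suc_diff_le_choose)
  also have "\<dots> = (\<Sum>S\<in>?\<S>. card {p \<in> perms n. S \<subseteq> hits n c p})"
    by (intro sum_choose_card_eq) (auto simp: hits_subset)
  also have "\<dots> \<le> (\<Sum>S\<in>?\<S>. 3 * card {p \<in> perms n. fixpts n p = S})"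
  proof (intro sum_mono)
    fix S assume "S \<in> ?\<S>"
    then have S: "S \<subseteq> {..<n}" "n - card S \<noteq> 1"
      using False by auto
    show "card {p \<in> perms n. S \<subseteq> hits n c p} \<le> 3 * card {p \<in> perms n. fixpts n p = S}"
      using card_hits_superset_le[OF assms(1) S(1)] fact_le_three_times_card_fixpts_eq[OF S] by linarith
  qed
  also have "\<dots> = 3 * card (\<Union>S\<in>?\<S>. {p \<in> perms n. fixpts n p = S})"
    unfolding sum_distrib_left[symmetric] by (subst card_UN_disjoint) (auto simp: disjoint_iff)
  also have "\<dots> \<le> 3 * card {p \<in> perms n. k \<le> card (fixpts n p)}"
    by (intro mult_left_mono card_mono) auto
  finally show ?thesis .
qed

text \<open>The excess over \<open>k - 1\<close> is a convex function of the number of hits, so passing to a convex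
  combination of boards does not spoil the bound for a single board.\<close>

lemma card_perms_avg_hits_ge_le:
  fixes w :: "'r \<Rightarrow> real"
  assumes "\<And>r. r \<in> R \<Longrightarrow> board n (c r)" "\<And>r. r \<in> R \<Longrightarrow> w r \<ge> 0" "(\<Sum>r\<in>R. w r) = 1"
  shows "card {p \<in> perms n. real k \<le> (\<Sum>r\<in>R. w r * card (hits n (c r) p))}
       \<le> 3 * card {p \<in> perms n. k \<le> card (fixpts n p)}"
proof (cases "k = 0")
  case True
  have "card {p \<in> perms n. real k \<le> (\<Sum>r\<in>R. w r * card (hits n (c r) p))} \<le> card (perms n)"
    by (intro card_mono) auto
  then show ?thesis
    using True by simp
next
  case False
  let ?G = "\<lambda>p. \<Sum>r\<in>R. w r * card (hits n (c r) p)"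
  let ?e = "\<lambda>r p. real (Suc (card (hits n (c r) p)) - k)"
  \<comment> \<open>Truncated subtraction dominates the true difference, and the weights sum to 1,
    so the averaged excess is at least \<open>1 - k + ?G p\<close>.\<close>
  have key: "of_bool (real k \<le> ?G p) \<le> (\<Sum>r\<in>R. w r * ?e r p)" for p
  proof (cases "real k \<le> ?G p")
    case True
    have "(\<Sum>r\<in>R. w r * (1 - real k + card (hits n (c r) p))) \<le> (\<Sum>r\<in>R. w r * ?e r p)"
      using assms(2) by (intro sum_mono mult_left_mono) (auto simp: of_nat_diff_real)
    moreover have "(\<Sum>r\<in>R. w r * (1 - real k + card (hits n (c r) p))) = (1 - real k) + ?G p"
      using assms(3) by (simp add: distrib_left sum.distrib flip: sum_distrib_right)
    ultimately show ?thesis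
      using True by simp
  next
    case False
    then show ?thesis
      using assms(2) by (simp add: sum_nonneg)
  qed
  have "real (card {p \<in> perms n. real k \<le> ?G p}) = (\<Sum>p\<in>perms n. of_bool (real k \<le> ?G p))"
    by (simp add: Collect_conj_eq)
  also have "\<dots> \<le> (\<Sum>p\<in>perms n. \<Sum>r\<in>R. w r * ?e r p)"
    by (intro sum_mono key)
  also have "\<dots> = (\<Sum>r\<in>R. w r * real (\<Sum>p\<in>perms n. Suc (card (hits n (c r) p)) - k))"
    by (subst sum.swap) (simp add: sum_distrib_left)
  also have "\<dots> \<le> (\<Sum>r\<in>R. w r * real (3 * card {p \<in> perms n. k \<le> card (fixpts n p)}))"
    using assms False by (intro sum_mono mult_left_mono) (simp_all only: of_nat_le_iff sum_excess_hits_le)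
  also have "\<dots> = real (3 * card {p \<in> perms n. k \<le> card (fixpts n p)})"
    using assms(3) by (simp flip: sum_distrib_right)
  finally show ?thesis
    by linarith
qed

subsection \<open>Step functions in rearrangement invariant spaces\<close>

lemma finite_decreasing_enumeration:
  fixes f :: "'a \<Rightarrow> 'b::linordered_idom"
  assumes "finite A"
  obtains e where "bij_betw e {..<card A} A"
    and "\<And>i j. i \<le> j \<Longrightarrow> j < card A \<Longrightarrow> f (e j) \<le> f (e i)"
proof -
  obtain xs where xs: "set xs = A" "distinct xs"
    using finite_distinct_list[OF assms] by blast
  define ys where "ys = sort_key (\<lambda>x. - f x) xs"
  have ys: "set ys = A" "distinct ys" "length ys = card A" "sorted (map (\<lambda>x. - f x) ys)"
    using xs distinct_card[OF xs(2)] by (auto simp: ys_def)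
  have "bij_betw ((!) ys) {..<card A} A"
    by (rule bij_betw_nth) (simp_all only: ys)
  moreover have "f (ys ! j) \<le> f (ys ! i)" if "i \<le> j" "j < card A" for i j
  proof -
    have "map (\<lambda>x. - f x) ys ! i \<le> map (\<lambda>x. - f x) ys ! j"
      using that ys(3) by (intro sorted_nth_mono[OF ys(4)]) simp_all
    then show ?thesis
      using that ys(3) by simp
  qed
  ultimately show ?thesis
    using that by blast
qed

context
  fixes E :: "(real \<Rightarrow> real) set" and N :: "(real \<Rightarrow> real) \<Rightarrow> real"
  assumes ri: "ri_space E N"
begin

lemma ri_triangle: "f \<in> E \<Longrightarrow> g \<in> E \<Longrightarrow> N (\<lambda>t. f t + g t) \<le> N f + N g"
  and ri_cmult: "f \<in> E \<Longrightarrow> (\<lambda>t. c * f t) \<in> E"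
  and ri_norm_cmult: "f \<in> E \<Longrightarrow> N (\<lambda>t. c * f t) = \<bar>c\<bar> * N f"
  using ri by (simp_all add: ri_space_def banach_function_space_def)

lemma ri_measurable: "f \<in> E \<Longrightarrow> f \<in> borel_measurable M01"
  using ri unfolding ri_space_def banach_function_space_def by blast

lemma ri_const: "(\<lambda>_. c) \<in> E" and ri_norm_const: "N (\<lambda>_. c) = \<bar>c\<bar>"
  using ri_cmult[of "\<lambda>_. 1" c] ri_norm_cmult[of "\<lambda>_. 1" c] ri
  unfolding ri_space_def by auto

text \<open>A smaller distribution function enlarges the set whose infimum is
  \<open>decr_rearr\<close>. From here on rearrangements are replaced by distribution
  functions.\<close>

lemma ri_distr_mono:
  assumes "f \<in> borel_measurable M01" "g \<in> E"
    and "\<And>s. emeasure M01 {u \<in> {0..1}. ennreal \<bar>f u\<bar> > s} \<le> emeasure M01 {u \<in> {0..1}. ennreal \<bar>g u\<bar> > s}"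
  shows "f \<in> E \<and> N f \<le> N g"
proof -
  have "decr_rearr f t \<le> decr_rearr g t" for t
    unfolding decr_rearr_def using assms(3) by (intro Inf_superset_mono) (auto intro: order_trans)
  then show ?thesis
    using ri assms(1,2) unfolding ri_space_def rearrangement_invariant_def by blast
qed

lemma ri_AE_mono:
  assumes [measurable]: "f \<in> borel_measurable M01" and "g \<in> E"
    and "AE t in M01. \<bar>f t\<bar> \<le> \<bar>g t\<bar>"
  shows "f \<in> E \<and> N f \<le> N g"
proof (rule ri_distr_mono[OF assms(1,2)])
  fix s
  have [measurable]: "g \<in> borel_measurable M01"
    using ri_measurable assms(2) by blast
  have "{u \<in> space M01. ennreal \<bar>g u\<bar> > s} \<in> sets M01"
    by measurable
  moreover have "AE u in M01. s < ennreal \<bar>f u\<bar> \<longrightarrow> s < ennreal \<bar>g u\<bar>"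
    using assms(3) by eventually_elim (auto intro: less_le_trans ennreal_leI)
  ultimately show "emeasure M01 {u \<in> {0..1}. ennreal \<bar>f u\<bar> > s} \<le> emeasure M01 {u \<in> {0..1}. ennreal \<bar>g u\<bar> > s}"
    by (intro emeasure_mono_AE) auto
qed

lemma ri_bounded:
  assumes "f \<in> borel_measurable M01" "\<And>t. t \<in> {0..1} \<Longrightarrow> \<bar>f t\<bar> \<le> c"
  shows "f \<in> E \<and> N f \<le> c"
proof -
  have "c \<ge> 0"
    using assms(2)[of 0] by simp
  have "AE t in M01. \<bar>f t\<bar> \<le> \<bar>c\<bar>"
    using assms(2) \<open>c \<ge> 0\<close> by (intro AE_I2) simp
  then show ?thesis
    using ri_AE_mono[OF assms(1) ri_const[of c]] \<open>c \<ge> 0\<close> by (simp add: ri_norm_const)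
qed

end

text \<open>\<open>T_op\<close> has this form with \<open>P\<close> the set of permutations. The
  function depends linearly on the heights \<open>h\<close>, so \<open>N\<close> becomes a seminorm
  on functions on \<open>P\<close>.\<close>

definition step :: "'p set \<Rightarrow> ('p \<Rightarrow> nat) \<Rightarrow> ('p \<Rightarrow> real) \<Rightarrow> real \<Rightarrow> real" where
  "step P l h t = (\<Sum>p\<in>P. h p * indicator {(real (l p) - 1) / card P ..< real (l p) / card P} t)"

lemma step_add: "step P l (\<lambda>p. g p + h p) t = step P l g t + step P l h t"
  by (simp add: step_def distrib_right sum.distrib)

lemma step_cmult: "step P l (\<lambda>p. c * h p) t = c * step P l h t"
  by (simp add: step_def sum_distrib_left mult.assoc)

lemma step_cong: "(\<And>p. p \<in> P \<Longrightarrow> g p = h p) \<Longrightarrow> step P l g = step P l h"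
  by (simp add: step_def fun_eq_iff)

lemma step_measurable [measurable]: "step P l h \<in> borel_measurable M01"
  unfolding step_def by (intro measurable_completion measurable_restrict_space1) measurable

context
  fixes P :: "'p set" and l :: "'p \<Rightarrow> nat"
  assumes fin: "finite P" and bij: "bij_betw l P {1..card P}"
begin

abbreviation (input) cell :: "'p \<Rightarrow> real set" where
  "cell p \<equiv> {(real (l p) - 1) / card P ..< real (l p) / card P}"

lemma cell_inj:
  assumes "p \<in> P" "p' \<in> P" "u \<in> cell p" "u \<in> cell p'"
  shows "p = p'"
proof -
  have "card P > 0"
    using fin assms(1) card_gt_0_iff by blast
  then have "real (l p) - 1 < real (l p')" "real (l p') - 1 < real (l p)"
    using assms(3,4) by (auto simp: field_simps)
  then have "l p = l p'"
    by linarith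
  then show ?thesis
    using bij assms(1,2) by (auto simp: bij_betw_def inj_on_def)
qed

lemma step_eq:
  assumes "p \<in> P" "u \<in> cell p"
  shows "step P l h u = h p"
proof -
  have "step P l h u = (\<Sum>p'\<in>P. if p' = p then h p else 0)"
    unfolding step_def using assms cell_inj by (intro sum.cong) (auto simp: indicator_def)
  then show ?thesis
    using fin assms(1) by simp
qed

lemma step_outside:
  assumes "\<And>p. p \<in> P \<Longrightarrow> u \<notin> cell p"
  shows "step P l h u = 0"
  unfolding step_def using assms by (intro sum.neutral) auto

lemma abs_step_le:
  assumes "c \<ge> 0" "\<And>p. p \<in> P \<Longrightarrow> \<bar>h p\<bar> \<le> c"
  shows "\<bar>step P l h u\<bar> \<le> c"
proof (cases "\<exists>p\<in>P. u \<in> cell p")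
  case True
  then obtain p where "p \<in> P" "u \<in> cell p"
    by blast
  then show ?thesis
    using assms(2) step_eq by metis
next
  case False
  then show ?thesis
    using assms(1) step_outside by simp
qed

text \<open>The steps are disjoint and each has length \<open>1 / card P\<close>, so distribution
  functions reduce to counting indices.\<close>

lemma emeasure_step_gt:
  "emeasure M01 {u \<in> {0..1}. ennreal \<bar>step P l h u\<bar> > s}
    = of_nat (card {p \<in> P. ennreal \<bar>h p\<bar> > s}) * ennreal (1 / card P)"
proof -
  let ?A = "{p \<in> P. ennreal \<bar>h p\<bar> > s}"
  have sub: "cell p \<subseteq> {0..1}" if "p \<in> P" for p
  proof -
    have "1 \<le> l p" "l p \<le> card P"
      using bij that by (auto simp: bij_betw_def)
    then have "0 \<le> (real (l p) - 1) / card P" "real (l p) / card P \<le> 1"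
      by (auto simp: field_simps)
    then show ?thesis
      by auto
  qed
  have "{u \<in> {0..1}. ennreal \<bar>step P l h u\<bar> > s} = (\<Union>p\<in>?A. cell p)"
  proof (intro equalityI subsetI)
    fix u assume u: "u \<in> {u \<in> {0..1}. ennreal \<bar>step P l h u\<bar> > s}"
    then obtain p where p: "p \<in> P" "u \<in> cell p"
      using step_outside[of u h] by fastforce
    then show "u \<in> (\<Union>p\<in>?A. cell p)"
      using u step_eq[OF p, of h] by auto
  next
    fix u assume "u \<in> (\<Union>p\<in>?A. cell p)"
    then obtain p where p: "p \<in> P" "u \<in> cell p" "ennreal \<bar>h p\<bar> > s"
      by auto
    then show "u \<in> {u \<in> {0..1}. ennreal \<bar>step P l h u\<bar> > s}"
      using step_eq[OF p(1,2), of h] sub[OF p(1)] by auto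
  qed
  also have "emeasure M01 \<dots> = (\<Sum>p\<in>?A. emeasure M01 (cell p))"
  proof (rule sum_emeasure[symmetric])
    show "disjoint_family_on cell ?A"
      using cell_inj unfolding disjoint_family_on_def by blast
    show "cell ` ?A \<subseteq> sets M01"
      using sub by (auto simp: sets_restrict_space_iff)
  qed (use fin in simp)
  also have "\<dots> = (\<Sum>p\<in>?A. ennreal (1 / card P))"
  proof (intro sum.cong refl)
    fix p assume "p \<in> ?A"
    then have p: "p \<in> P"
      by simp
    have "emeasure M01 (cell p) = emeasure lebesgue (cell p)"
      using sub[OF p] by (intro emeasure_restrict_space) auto
    also have "\<dots> = ennreal (1 / card P)"
      by (simp add: divide_right_mono flip: diff_divide_distrib)
    finally show "emeasure M01 (cell p) = ennreal (1 / card P)" .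
  qed
  finally show ?thesis
    by simp
qed

context
  fixes E :: "(real \<Rightarrow> real) set" and N :: "(real \<Rightarrow> real) \<Rightarrow> real"
  assumes ri: "ri_space E N"
begin

lemma step_in_E: "step P l h \<in> E"
proof -
  have "\<bar>h p\<bar> \<le> (\<Sum>p\<in>P. \<bar>h p\<bar>)" if "p \<in> P" for p
    using fin that by (intro member_le_sum) auto
  then show ?thesis
    using ri_bounded[OF ri step_measurable] abs_step_le by (meson abs_ge_zero sum_nonneg)
qed

lemma N_step_add_le: "N (step P l (\<lambda>p. g p + h p)) \<le> N (step P l g) + N (step P l h)"
  using ri_triangle[OF ri step_in_E step_in_E] by (simp add: step_add[abs_def])

lemma N_step_cmult: "N (step P l (\<lambda>p. c * h p)) = \<bar>c\<bar> * N (step P l h)"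
  using ri_norm_cmult[OF ri step_in_E] by (simp add: step_cmult[abs_def])

lemma N_step_distr_mono:
  assumes "\<And>s. s \<ge> 0 \<Longrightarrow> card {p \<in> P. \<bar>g p\<bar> > s} \<le> card {p \<in> P. \<bar>h p\<bar> > s}"
  shows "N (step P l g) \<le> N (step P l h)"
proof -
  have "card {p \<in> P. ennreal \<bar>g p\<bar> > s} \<le> card {p \<in> P. ennreal \<bar>h p\<bar> > s}" for s
  \<comment> \<open>The thresholds in \<open>decr_rearr\<close> are extended reals; at infinity both
    sets are empty.\<close>
  proof (cases s)
    case (real r)
    then show ?thesis
      using assms by (simp add: ennreal_less_iff)
  qed simp
  then show ?thesis
    by (intro ri_distr_mono[OF ri step_measurable step_in_E, THEN conjunct2])
       (simp only: emeasure_step_gt, intro mult_right_mono, simp_all)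
qed

lemma N_step_mono:
  assumes "\<And>p. p \<in> P \<Longrightarrow> \<bar>g p\<bar> \<le> \<bar>h p\<bar>"
  shows "N (step P l g) \<le> N (step P l h)"
  using fin assms by (intro N_step_distr_mono card_mono) (auto intro: less_le_trans)

lemma N_step_bounded:
  assumes "c \<ge> 0" "\<And>p. p \<in> P \<Longrightarrow> \<bar>h p\<bar> \<le> c"
  shows "N (step P l h) \<le> c"
  by (intro ri_bounded[OF ri step_measurable, THEN conjunct2] abs_step_le assms)

text \<open>Splitting the ranks of the values of \<open>g\<close> modulo 3 writes \<open>g\<close> as a sum of three functions,
  each distributionally dominated by \<open>h\<close>.\<close>

lemma N_step_distr_three:
  assumes "\<And>p. p \<in> P \<Longrightarrow> g p \<ge> 0" "\<And>p. p \<in> P \<Longrightarrow> h p \<ge> 0"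
    and dom: "\<And>s. s \<ge> 0 \<Longrightarrow> card {p \<in> P. g p > s} \<le> 3 * card {p \<in> P. h p > s}"
  shows "N (step P l g) \<le> 3 * N (step P l h)"
proof -
  obtain a where a: "bij_betw a {..<card P} P"
    and a_mono: "\<And>i j. i \<le> j \<Longrightarrow> j < card P \<Longrightarrow> g (a j) \<le> g (a i)"
    using finite_decreasing_enumeration[OF fin, of g] by blast
  obtain b where b: "bij_betw b {..<card P} P"
    and b_mono: "\<And>i j. i \<le> j \<Longrightarrow> j < card P \<Longrightarrow> h (b j) \<le> h (b i)"
    using finite_decreasing_enumeration[OF fin, of h] by blast
  define rk where "rk = inv_into {..<card P} a"
  have rk: "rk p < card P" "a (rk p) = p" if "p \<in> P" for p
    using that a by (auto simp: rk_def bij_betw_def inv_into_into f_inv_into_f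
        intro: inv_into_into[of p a "{..<card P}", simplified])
  have b_in: "b i \<in> P" if "i < card P" for i
    using b that by (auto simp: bij_betw_def)
  \<comment> \<open>Otherwise \<open>i + 1\<close> values of \<open>g\<close> exceed the value of
    \<open>h\<close> at rank \<open>i div 3\<close>, which at most \<open>i div 3\<close> values of
    \<open>h\<close> do. The factor 3 would give \<open>i + 1 \<le> 3 * (i div 3)\<close>.\<close>
  have le: "g (a i) \<le> h (b (i div 3))" if "i < card P" for i
  proof (rule ccontr)
    assume "\<not> g (a i) \<le> h (b (i div 3))"
    then have less: "h (b (i div 3)) < g (a i)"
      by simp
    let ?s = "h (b (i div 3))"
    have "a ` {..i} \<subseteq> {p \<in> P. g p > ?s}"
      using a that less a_mono by (fastforce simp: bij_betw_def)
    moreover have "card (a ` {..i}) = Suc i"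
      using a that by (subst card_image) (auto simp: bij_betw_def intro: inj_on_subset)
    ultimately have "Suc i \<le> card {p \<in> P. g p > ?s}"
      using fin card_mono[of "{p \<in> P. g p > ?s}" "a ` {..i}"] by simp
    moreover have "{p \<in> P. h p > ?s} \<subseteq> b ` {..<i div 3}"
    proof
      fix p assume p: "p \<in> {p \<in> P. h p > ?s}"
      then obtain k where k: "k < card P" "p = b k"
        using b by (auto simp: bij_betw_def)
      then have "k < i div 3"
        using p b_mono[of "i div 3" k] by (cases "k < i div 3") auto
      then show "p \<in> b ` {..<i div 3}"
        using k by blast
    qed
    then have "card {p \<in> P. h p > ?s} \<le> i div 3"
      using surj_card_le[of "{..<i div 3}"] by simp
    moreover have "i div 3 < card P"
      using that by linarith
    then have "?s \<ge> 0"
      using assms(2) b_in by blast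
    ultimately show False
      using dom[of ?s] by linarith
  qed
  \<comment> \<open>Within one residue class \<open>rk p\<close> is determined by
    \<open>rk p div 3\<close>, so sending \<open>p\<close> to \<open>b (rk p div 3)\<close> is
    injective there, and by \<open>le\<close> it does not decrease the value.\<close>
  define g' where "g' = (\<lambda>r p. if rk p mod 3 = r then g p else 0)"
  have part: "N (step P l (g' r)) \<le> N (step P l h)" for r
  proof (rule N_step_distr_mono)
    fix s :: real assume "s \<ge> 0"
    let ?f = "\<lambda>p. b (rk p div 3)"
    have *: "rk p mod 3 = r" "g p > s" "p \<in> P" if "p \<in> P" "\<bar>g' r p\<bar> > s" for p
      using that assms(1) \<open>s \<ge> 0\<close> by (auto simp: g'_def split: if_splits)
    have "inj_on ?f {p \<in> P. \<bar>g' r p\<bar> > s}"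
    proof (rule inj_onI)
      fix p p'
      assume p: "p \<in> {p \<in> P. \<bar>g' r p\<bar> > s}" and p': "p' \<in> {p \<in> P. \<bar>g' r p\<bar> > s}"
        and eq: "b (rk p div 3) = b (rk p' div 3)"
      have "rk p div 3 < card P" "rk p' div 3 < card P"
        using p p' rk(1) by (auto intro: le_less_trans[OF div_le_dividend])
      then have "rk p div 3 = rk p' div 3"
        using b eq by (auto simp: bij_betw_def inj_on_def)
      moreover have "rk p mod 3 = rk p' mod 3"
        using p p' * by simp
      ultimately have "rk p = rk p'"
        by (metis div_mod_decomp)
      then show "p = p'"
        using rk(2) p p' by (metis (no_types, lifting) mem_Collect_eq)
    qed
    moreover have "?f ` {p \<in> P. \<bar>g' r p\<bar> > s} \<subseteq> {p \<in> P. \<bar>h p\<bar> > s}"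
    proof safe
      fix p assume p: "p \<in> P" "\<bar>g' r p\<bar> > s"
      have lt: "rk p div 3 < card P"
        using rk(1)[OF p(1)] by (auto intro: le_less_trans[OF div_le_dividend])
      show "b (rk p div 3) \<in> P"
        using b_in[OF lt] .
      show "s < \<bar>h (b (rk p div 3))\<bar>"
        using le[OF rk(1)[OF p(1)]] *(2)[OF p] rk(2)[OF p(1)] by simp
    qed
    ultimately show "card {p \<in> P. \<bar>g' r p\<bar> > s} \<le> card {p \<in> P. \<bar>h p\<bar> > s}"
      using fin by (intro card_inj_on_le[of ?f]) auto
  qed
  have "g = (\<lambda>p. g' 0 p + (g' 1 p + g' 2 p))"
    by (auto simp: g'_def fun_eq_iff)
  then have "N (step P l g) \<le> N (step P l (g' 0)) + N (step P l (\<lambda>p. g' 1 p + g' 2 p))"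
    using N_step_add_le[of "g' 0" "\<lambda>p. g' 1 p + g' 2 p"] by simp
  also have "\<dots> \<le> N (step P l (g' 0)) + (N (step P l (g' 1)) + N (step P l (g' 2)))"
    using N_step_add_le by (intro add_left_mono)
  also have "\<dots> \<le> 3 * N (step P l h)"
    using part[of 0] part[of 1] part[of 2] by simp
  finally show ?thesis .
qed

end

end

text \<open>The sorted list depends only on the multiset of absolute values, so any decreasing
  enumeration of the cells computes it. Enumerations start at 0 but \<open>mat_rearr\<close> at 1,
  hence \<open>k - 1\<close>.\<close>

lemma mat_rearr_eqI:
  assumes x: "x \<in> carrier_mat n n" and e: "bij_betw e {..<n^2} ({..<n} \<times> {..<n})"
    and v: "\<And>k. k < n^2 \<Longrightarrow> \<bar>x $$ e k\<bar> = v k"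
    and mono: "\<And>i j. i \<le> j \<Longrightarrow> j < n^2 \<Longrightarrow> v j \<le> v i"
    and k: "1 \<le> k" "k \<le> n^2"
  shows "mat_rearr x k = v (k - 1)"
proof -
  let ?L = "[\<bar>x $$ (i, j)\<bar>. i \<leftarrow> [0..<n], j \<leftarrow> [0..<n]]"
  have "?L = map (\<lambda>c. \<bar>x $$ c\<bar>) (List.product [0..<n] [0..<n])"
    by (simp add: product_concat_map map_concat comp_def)
  moreover have "mset (List.product [0..<n] [0..<n]) = mset_set ({..<n} \<times> {..<n})"
    using mset_set_set[of "List.product [0..<n] [0..<n]"]
    by (simp add: distinct_product atLeast0LessThan)
  ultimately have "mset ?L = image_mset (\<lambda>c. \<bar>x $$ c\<bar>) (image_mset e (mset_set {..<n^2}))"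
    using e by (simp add: bij_betw_def image_mset_mset_set)
  also have "\<dots> = image_mset v (mset_set {..<n^2})"
    unfolding multiset.map_comp using v by (intro image_mset_cong) auto
  also have "\<dots> = mset (rev (map v [0..<n^2]))"
    by (simp add: atLeast0LessThan)
  finally have "mset (rev (map v [0..<n^2])) = mset ?L"
    by (rule sym)
  moreover have "sorted (rev (map v [0..<n^2]))"
    unfolding sorted_iff_nth_mono by (auto simp: rev_nth intro!: mono)
  ultimately have "sort ?L = rev (map v [0..<n^2])"
    by (rule properties_for_sort)
  then show ?thesis
    using x k by (simp add: mat_rearr_def)
qed

lemma mat_rearr_enumeration:
  assumes "x \<in> carrier_mat n n"
  obtains e where "bij_betw e {..<n^2} ({..<n} \<times> {..<n})"
    and "\<And>k. k < n^2 \<Longrightarrow> \<bar>x $$ e k\<bar> = mat_rearr x (Suc k)"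
    and "\<And>i j. i \<le> j \<Longrightarrow> j < n^2 \<Longrightarrow> mat_rearr x (Suc j) \<le> mat_rearr x (Suc i)"
proof -
  obtain e where e: "bij_betw e {..<n^2} ({..<n} \<times> {..<n})"
    and mono: "\<And>i j. i \<le> j \<Longrightarrow> j < n^2 \<Longrightarrow> \<bar>x $$ e j\<bar> \<le> \<bar>x $$ e i\<bar>"
    using finite_decreasing_enumeration[of "{..<n} \<times> {..<n}" "\<lambda>c. \<bar>x $$ c\<bar>"]
    by (auto simp: power2_eq_square)
  have "mat_rearr x (Suc k) = \<bar>x $$ e k\<bar>" if "k < n^2" for k
    using mat_rearr_eqI[OF assms e, of "\<lambda>k. \<bar>x $$ e k\<bar>" "Suc k"] mono that by simp
  then show ?thesis
    using that[of e] e mono by simp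
qed

subsection \<open>Matrices\<close>

text \<open>After division by \<open>a + b\<close> the summands lie in \<open>[0,1]\<close>, where
  \<open>c \<le> c powr s\<close>. It is applied with \<open>s = 1 / q\<close>.\<close>

lemma powr_add_le_add_powr:
  fixes a b s :: real
  assumes "a \<ge> 0" "b \<ge> 0" "0 < s" "s \<le> 1"
  shows "(a + b) powr s \<le> a powr s + b powr s"
proof (cases "a + b = 0")
  case False
  then have t: "a + b > 0"
    using assms by linarith
  have *: "c / (a + b) \<le> c powr s / (a + b) powr s" if "0 \<le> c" "c \<le> a + b" for c
    using powr_mono'[of s 1 "c / (a + b)"] assms that t by (simp add: powr_divide)
  have "1 = a / (a + b) + b / (a + b)"
    using t by (simp flip: add_divide_distrib)
  also have "\<dots> \<le> (a powr s + b powr s) / (a + b) powr s"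
    using *[of a] *[of b] assms by (simp add: add_divide_distrib)
  finally show ?thesis
    using t by (simp add: field_simps)
qed (use assms in simp)

text \<open>Real thresholds for the root of a count become integer thresholds for the count, as the
  counting lemmas require.\<close>

lemma less_root_nat_iff:
  fixes s q :: real
  assumes "s \<ge> 0" "q > 0"
  shows "s < real m powr (1 / q) \<longleftrightarrow> Suc (nat \<lfloor>s powr q\<rfloor>) \<le> m"
proof -
  have "s < real m powr (1 / q) \<longleftrightarrow> s powr q < real m"
  proof
    assume "s < real m powr (1 / q)"
    then have "s powr q < (real m powr (1 / q)) powr q"
      using assms by (intro powr_less_mono2) auto
    then show "s powr q < real m"
      using assms by (simp add: powr_powr)
  next
    assume "s powr q < real m"
    then have "(s powr q) powr (1 / q) < real m powr (1 / q)"
      using assms by (intro powr_less_mono2) auto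
    then show "s < real m powr (1 / q)"
      using assms by (simp add: powr_powr)
  qed
  also have "\<dots> \<longleftrightarrow> Suc (nat \<lfloor>s powr q\<rfloor>) \<le> m"
    using powr_ge_zero[of s q] by linarith
  finally show ?thesis .
qed

lemma sum_blocks:
  fixes F :: "nat \<Rightarrow> 'a::comm_monoid_add"
  shows "(\<Sum>k<m * n. F k) = (\<Sum>r<m. \<Sum>j<n. F (r * n + j))"
proof -
  have "sum F {r * n..<r * n + n} = (\<Sum>j<n. F (r * n + j))" for r
    by (rule sum.reindex_bij_witness[of _ "\<lambda>j. r * n + j" "\<lambda>k. k - r * n"]) auto
  then show ?thesis
    by (simp flip: sum.nat_group)
qed

lemma block_index_less:
  fixes n :: nat
  assumes "r < n" "j < n"
  shows "r * n + j < n^2"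
proof -
  have "r * n + j < Suc r * n"
    using assms by simp
  also have "\<dots> \<le> n * n"
    using assms by (intro mult_right_mono) auto
  finally show ?thesis
    by (simp add: power2_eq_square)
qed

text \<open>The enumeration \<open>e\<close> is cut into \<open>n\<close> consecutive blocks of
  \<open>n\<close> cells, each of them a board; every cell on the graph of \<open>p\<close> is a hit
  in exactly one block.\<close>

lemma sum_perm_entries:
  fixes g :: "nat \<times> nat \<Rightarrow> real"
  assumes e: "bij_betw e {..<n^2} ({..<n} \<times> {..<n})" and p: "p permutes {..<n}"
  shows "(\<Sum>i<n. g (i, p i)) = (\<Sum>r<n. \<Sum>j\<in>hits n (\<lambda>j. e (r * n + j)) p. g (e (r * n + j)))"
proof -
  let ?h = "\<lambda>c. if p (fst c) = snd c then g c else 0"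
  have "(\<Sum>i<n. g (i, p i)) = (\<Sum>i<n. \<Sum>j<n. ?h (i, j))"
    using permutes_in_image[OF p] by (intro sum.cong) auto
  also have "\<dots> = (\<Sum>c\<in>{..<n} \<times> {..<n}. ?h c)"
    unfolding sum.cartesian_product by (intro sum.cong) (auto simp: split_def)
  also have "\<dots> = (\<Sum>k<n * n. ?h (e k))"
    using sum.reindex_bij_betw[OF e, of ?h] by (simp add: power2_eq_square)
  also have "\<dots> = (\<Sum>r<n. \<Sum>j<n. ?h (e (r * n + j)))"
    by (rule sum_blocks)
  also have "\<dots> = (\<Sum>r<n. \<Sum>j\<in>hits n (\<lambda>j. e (r * n + j)) p. g (e (r * n + j)))"
    by (intro sum.cong sum.mono_neutral_cong_right) (auto simp: hits_def)
  finally show ?thesis .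
qed

lemma board_block:
  assumes "bij_betw e {..<n^2} ({..<n} \<times> {..<n})" "r < n"
  shows "board n (\<lambda>j. e (r * n + j))"
  unfolding board_def
proof
  show "inj_on (\<lambda>j. e (r * n + j)) {..<n}"
  proof (rule inj_onI)
    fix i j assume "i \<in> {..<n}" "j \<in> {..<n}" "e (r * n + i) = e (r * n + j)"
    then have "r * n + i = r * n + j"
      using assms block_index_less by (intro inj_onD[OF bij_betw_imp_inj_on[OF assms(1)]]) auto
    then show "i = j"
      by simp
  qed
  show "(\<lambda>j. e (r * n + j)) ` {..<n} \<subseteq> {..<n} \<times> {..<n}"
  proof (rule image_subsetI)
    fix j assume "j \<in> {..<n}"
    then have "r * n + j \<in> {..<n^2}"
      using assms(2) block_index_less by simp
    then show "e (r * n + j) \<in> {..<n} \<times> {..<n}"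
      using bij_betw_apply[OF assms(1)] by blast
  qed
qed

section \<open>The operators \<open>T_op\<close> and \<open>U_op\<close>, and diagonal
  matrices\<close>

lemma T_op_eq_step:
  assumes "y \<in> carrier_mat n n"
  shows "T_op l q y = step (perms n) l (\<lambda>p. (\<Sum>i<n. \<bar>y $$ (i, p i)\<bar> powr q) powr (1 / q))"
  using assms by (simp add: T_op_def step_def fun_eq_iff)

definition diag_of :: "nat \<Rightarrow> (nat \<Rightarrow> real) \<Rightarrow> real mat" where
  "diag_of n v = mat n n (\<lambda>(i, j). if i = j then v i else 0)"

lemma diag_of_carrier [simp]: "diag_of n v \<in> carrier_mat n n"
  by (simp add: diag_of_def)

lemma diagonal_diag_of: "diagonal_mat (diag_of n v)"
  by (simp add: diag_of_def diagonal_mat_def)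

lemma T_op_diag_of:
  assumes "\<And>j. j < n \<Longrightarrow> v j \<ge> 0"
  shows "T_op l q (diag_of n v)
    = step (perms n) l (\<lambda>p. (\<Sum>j\<in>fixpts n p. v j powr q) powr (1 / q))"
  unfolding T_op_eq_step[OF diag_of_carrier]
proof (rule step_cong)
  fix p assume "p \<in> perms n"
  then have "p i < n" if "i < n" for i
    using permutes_in_image[of p "{..<n}"] that by auto
  then have "(\<Sum>i<n. \<bar>diag_of n v $$ (i, p i)\<bar> powr q) = (\<Sum>j\<in>fixpts n p. v j powr q)"
    using assms by (intro sum.mono_neutral_cong_right) (auto simp: hits_def diag_of_def)
  then show "(\<Sum>i<n. \<bar>diag_of n v $$ (i, p i)\<bar> powr q) powr (1 / q)
      = (\<Sum>j\<in>fixpts n p. v j powr q) powr (1 / q)"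
    by simp
qed

text \<open>List the diagonal first and the zeros off it afterwards; since \<open>v\<close> is
  nonnegative and decreasing, this enumeration is decreasing.\<close>

lemma mat_rearr_diag_of:
  assumes nonneg: "\<And>j. j < n \<Longrightarrow> v j \<ge> 0"
    and mono: "\<And>i j. i \<le> j \<Longrightarrow> j < n \<Longrightarrow> v j \<le> v i"
    and k: "1 \<le> k" "k \<le> n"
  shows "mat_rearr (diag_of n v) k = v (k - 1)"
proof -
  let ?D = "(\<lambda>k. (k, k)) ` {..<n}"
  have nn: "n \<le> n^2"
    by (simp add: power2_eq_square)
  have D: "?D \<subseteq> {..<n} \<times> {..<n}" "card ?D = n"
    by (auto simp: card_image inj_on_def)
  have "card {n..<n^2} = card ({..<n} \<times> {..<n} - ?D)"
    using D by (simp add: card_Diff_subset power2_eq_square)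
  then obtain d where d: "bij_betw d {n..<n^2} ({..<n} \<times> {..<n} - ?D)"
    using finite_same_card_bij[of "{n..<n^2}" "{..<n} \<times> {..<n} - ?D"] by auto
  define e where "e = (\<lambda>k. if k < n then (k, k) else d k)"
  have "bij_betw e ({..<n} \<union> {n..<n^2}) (?D \<union> ({..<n} \<times> {..<n} - ?D))"
  proof (rule bij_betw_combine)
    show "bij_betw e {..<n} ?D"
      by (auto simp: bij_betw_def e_def inj_on_def)
    show "bij_betw e {n..<n^2} ({..<n} \<times> {..<n} - ?D)"
      using d by (rule bij_betw_cong[THEN iffD1, rotated]) (simp add: e_def)
  qed blast
  moreover have "{..<n} \<union> {n..<n^2} = {..<n^2}"
    using nn by auto
  moreover have "?D \<union> ({..<n} \<times> {..<n} - ?D) = {..<n} \<times> {..<n}"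
    using D by blast
  ultimately have e: "bij_betw e {..<n^2} ({..<n} \<times> {..<n})"
    by simp
  define v' where "v' = (\<lambda>k. if k < n then v k else 0)"
  have v': "\<bar>diag_of n v $$ e k\<bar> = v' k" if "k < n^2" for k
  proof (cases "k < n")
    case True
    then show ?thesis
      using nonneg by (simp add: e_def v'_def diag_of_def)
  next
    case False
    then have "d k \<in> {..<n} \<times> {..<n} - ?D"
      using that bij_betw_apply[OF d] by simp
    then show ?thesis
      using False by (cases "d k") (auto simp: e_def v'_def diag_of_def)
  qed
  have "v' j \<le> v' i" if "i \<le> j" for i j
    using that nonneg mono by (auto simp: v'_def)
  then have "mat_rearr (diag_of n v) k = v' (k - 1)"
    using mat_rearr_eqI[OF diag_of_carrier e v'] k nn by simp
  then show ?thesis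
    using k by (simp add: v'_def)
qed

text \<open>The intervals in \<open>U_op\<close> are open, so the finitely many points
  \<open>k / n\<close> have to be left out.\<close>

lemma U_op_AE:
  assumes "x \<in> carrier_mat n n" "n \<ge> 1"
  shows "AE t in M01. \<exists>k\<in>{1..n}. U_op x t = mat_rearr x k"
proof -
  let ?Z = "(\<lambda>k. real k / real n) ` {..n}"
  have negl: "negligible (?Z \<inter> {0..1})"
    by (intro negligible_finite) simp
  have "emeasure M01 (?Z \<inter> {0..1}) = 0"
  proof -
    from negl have "emeasure lebesgue (?Z \<inter> {0..1}) = 0"
      by (simp add: negligible_iff_null_sets null_setsD1)
    then show ?thesis
      by (subst emeasure_restrict_space) auto
  qed
  then have "AE t in M01. t \<notin> ?Z \<inter> {0..1}"
    using negligible_imp_sets[OF negl]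
    by (intro AE_not_in null_setsI) (simp_all add: sets_restrict_space_iff)
  moreover have "AE t in M01. t \<in> {0..1}"
    by (intro AE_I2) simp
  ultimately show ?thesis
  proof eventually_elim
    case (elim t)
    \<comment> \<open>Since \<open>t * n\<close> is not an integer, its ceiling is the index of the
      open interval containing \<open>t\<close>.\<close>
    define k where "k = nat \<lceil>t * real n\<rceil>"
    have tn: "t * real n \<noteq> real j" if "j \<le> n" for j
    proof
      assume "t * real n = real j"
      then have "t = real j / real n"
        using assms(2) by (simp add: field_simps)
      then show False
        using elim that by blast
    qed
    have "t * real n \<ge> 0" "t * real n \<le> real n"
      using elim assms(2) by (auto intro: mult_left_le_one_le)
    moreover have "t * real n \<noteq> 0"
      using tn[OF le0] by (simp only: of_nat_0 not_False_eq_True)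
    ultimately have "0 < t * real n" "k \<le> n" "1 \<le> k"
      unfolding k_def by linarith+
    then have k: "k \<in> {1..n}" "real k - 1 < t * real n" "t * real n < real k"
      using tn[of k] unfolding k_def atLeastAtMost_iff by linarith+
    have "U_op x t = (\<Sum>j = 1..n. if j = k then mat_rearr x k else 0)"
    proof -
      have "mat_rearr x j * indicator {(real j - 1) / real n<..<real j / real n} t
          = (if j = k then mat_rearr x k else 0)" for j
      proof -
        have "t \<in> {(real j - 1) / real n<..<real j / real n}
            \<longleftrightarrow> real j - 1 < t * real n \<and> t * real n < real j"
          using assms(2) by (auto simp: field_simps)
        also have "\<dots> \<longleftrightarrow> j = k"
          using k by auto
        finally show ?thesis
          by (simp add: indicator_def)
      qed
      moreover have "dim_row x = n"
        using assms(1) by simp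
      ultimately show ?thesis
        by (simp only: U_op_def Let_def)
    qed
    then show ?case
      using k(1) by auto
  qed
qed

lemma U_op_cong:
  assumes "x \<in> carrier_mat n n" "y \<in> carrier_mat n n"
    and "\<And>k. 1 \<le> k \<Longrightarrow> k \<le> n \<Longrightarrow> mat_rearr x k = mat_rearr y k"
  shows "U_op x = U_op y"
  using assms by (simp add: U_op_def fun_eq_iff)

lemma U_op_measurable: "U_op x \<in> borel_measurable M01"
  unfolding U_op_def Let_def by (intro measurable_completion measurable_restrict_space1) measurable

lemma N_U_op_le:
  assumes "ri_space E N" "x \<in> carrier_mat n n" "n \<ge> 1"
    and "\<And>k. 1 \<le> k \<Longrightarrow> k \<le> n \<Longrightarrow> \<bar>mat_rearr x k\<bar> \<le> c"
  shows "U_op x \<in> E \<and> N (U_op x) \<le> \<bar>c\<bar>"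
proof -
  have "AE t in M01. \<bar>U_op x t\<bar> \<le> \<bar>c\<bar>"
    using U_op_AE[OF assms(2,3)] by eventually_elim (use assms(4) in fastforce)
  then show ?thesis
    using ri_AE_mono[OF assms(1) U_op_measurable ri_const[OF assms(1)]] ri_norm_const[OF assms(1)]
    by metis
qed

lemma le_N_U_op:
  assumes "ri_space E N" "x \<in> carrier_mat n n" "n \<ge> 1"
    and "\<And>k. 1 \<le> k \<Longrightarrow> k \<le> n \<Longrightarrow> c \<le> \<bar>mat_rearr x k\<bar>" "c \<ge> 0"
  shows "c \<le> N (U_op x)"
proof -
  \<comment> \<open>A crude upper bound, used only to place \<open>U_op x\<close> in
    \<open>E\<close>.\<close>
  have "\<bar>mat_rearr x k\<bar> \<le> (\<Sum>k=1..n. \<bar>mat_rearr x k\<bar>)" if "1 \<le> k" "k \<le> n" for k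
    using that by (intro member_le_sum) auto
  then have "U_op x \<in> E"
    using N_U_op_le[OF assms(1-3)] by blast
  moreover have "AE t in M01. \<bar>c\<bar> \<le> \<bar>U_op x t\<bar>"
    using U_op_AE[OF assms(2,3)] by eventually_elim (use assms(4,5) in fastforce)
  ultimately have "N (\<lambda>_. c) \<le> N (U_op x)"
    using ri_AE_mono[OF assms(1), of "\<lambda>_. c" "U_op x"] by simp
  then show ?thesis
    using ri_norm_const[OF assms(1)] assms(5) by simp
qed

section \<open>Norm estimates for hit counts\<close>

context
  fixes n :: nat and q :: real and E :: "(real \<Rightarrow> real) set" and N :: "(real \<Rightarrow> real) \<Rightarrow> real"
    and l :: "(nat \<Rightarrow> nat) \<Rightarrow> nat"
  assumes q: "q > 1" and ri: "ri_space E N" and l: "bij_betw l (perms n) {1..fact n}"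
begin

lemma bij_l: "bij_betw l (perms n) {1..card (perms n)}"
  using l by simp

text \<open>As the weights are nonnegative, exceeding a level is an upward closed property of the
  hit set. The counting lemma then costs a factor 3 in distribution, hence 3 in norm.\<close>

lemma N_step_hits_le:
  assumes "board n c" "\<And>j. j < n \<Longrightarrow> w j \<ge> 0"
  shows "N (step (perms n) l (\<lambda>p. (\<Sum>j\<in>hits n c p. w j) powr (1 / q)))
    \<le> 3 * N (step (perms n) l (\<lambda>p. (\<Sum>j\<in>fixpts n p. w j) powr (1 / q)))"
proof (rule N_step_distr_three[OF finite_perms bij_l ri])
  fix s :: real assume "s \<ge> 0"
  have mono: "(\<Sum>j\<in>S. w j) powr (1 / q) \<le> (\<Sum>j\<in>T. w j) powr (1 / q)"
    if "S \<subseteq> T" "T \<subseteq> {..<n}" for S T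
    using that assms(2) q finite_subset[OF that(2)]
    by (intro powr_mono2 sum_mono2 sum_nonneg) auto
  show "card {p \<in> perms n. (\<Sum>j\<in>hits n c p. w j) powr (1 / q) > s}
      \<le> 3 * card {p \<in> perms n. (\<Sum>j\<in>fixpts n p. w j) powr (1 / q) > s}"
    using mono by (intro card_perms_hits_upclosed_le[OF assms(1)]) (auto intro: less_le_trans)
qed auto

text \<open>Normalising the weights gives an average \<open>G\<close> of hit counts, whose
  distribution is controlled at integer levels only. It is therefore rounded down to
  \<open>K\<close>, and subadditivity of the root turns \<open>G \<le> K + 1\<close> into the
  summand 1.\<close>

lemma N_step_weighted_hits_le:
  fixes b :: "'r \<Rightarrow> real"
  assumes "\<And>r. r \<in> R \<Longrightarrow> board n (c r)" "\<And>r. r \<in> R \<Longrightarrow> b r \<ge> 0"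
  shows "N (step (perms n) l (\<lambda>p. (\<Sum>r\<in>R. b r * card (hits n (c r) p)) powr (1 / q)))
    \<le> (\<Sum>r\<in>R. b r) powr (1 / q) * (3 * N (step (perms n) l (\<lambda>p. card (fixpts n p) powr (1 / q))) + 1)"
proof -
  note stp = finite_perms bij_l ri
  define S where "S = (\<Sum>r\<in>R. b r)"
  define G where "G = (\<lambda>p. \<Sum>r\<in>R. b r / S * card (hits n (c r) p))"
  define K where "K = (\<lambda>p. nat \<lfloor>G p\<rfloor>)"
  let ?M = "\<lambda>p. \<Sum>r\<in>R. b r * card (hits n (c r) p)"
  have S: "S \<ge> 0"
    using assms(2) by (simp add: S_def sum_nonneg)
  have G: "G p \<ge> 0" for p
    using assms(2) S by (simp add: G_def sum_nonneg)
  \<comment> \<open>Division by \<open>S = 0\<close> makes \<open>G\<close> zero. The identity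
    survives: either all weights vanish or \<open>R\<close> is infinite and the sums are 0 by
    convention.\<close>
  have SG: "?M p = S * G p" for p
  proof (cases "S = 0")
    case True
    show ?thesis
    proof (cases "finite R")
      case True
      then have "b r = 0" if "r \<in> R" for r
        using that assms(2) \<open>S = 0\<close> by (simp add: S_def sum_nonneg_eq_0_iff)
      then show ?thesis
        using \<open>S = 0\<close> by simp
    qed (simp add: G_def)
  next
    case False
    then show ?thesis
      by (simp add: G_def sum_distrib_left)
  qed
  have domK: "N (step (perms n) l (\<lambda>p. K p powr (1 / q)))
      \<le> 3 * N (step (perms n) l (\<lambda>p. card (fixpts n p) powr (1 / q)))"
  proof (cases "S = 0")
    case True
    then have "K p = 0" for p
      by (simp add: K_def G_def)
    then have "N (step (perms n) l (\<lambda>p. K p powr (1 / q))) \<le> 0"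
      using q by (intro N_step_bounded[OF stp]) auto
    \<comment> \<open>Comparison with the zero function shows that the norm on the right is
      nonnegative.\<close>
    moreover have "N (step (perms n) l (\<lambda>p. 0)) \<le> N (step (perms n) l (\<lambda>p. card (fixpts n p) powr (1 / q)))"
      by (intro N_step_mono[OF stp]) auto
    moreover have "N (step (perms n) l (\<lambda>p. 0)) = 0"
      using N_step_cmult[OF stp, of 0 "\<lambda>_. 0"] by simp
    ultimately show ?thesis
      by linarith
  next
    case False
    show ?thesis
    proof (rule N_step_distr_three[OF stp])
      fix s :: real assume s: "s \<ge> 0"
      let ?k = "Suc (nat \<lfloor>s powr q\<rfloor>)"
      \<comment> \<open>Integer levels do not see the rounding, so the bound for \<open>G\<close>
        passes to \<open>K\<close>.\<close>
      have "?k \<le> K p \<longleftrightarrow> real ?k \<le> G p" for p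
        using G[of p] unfolding K_def by linarith
      then have "card {p \<in> perms n. K p powr (1 / q) > s} = card {p \<in> perms n. real ?k \<le> G p}"
        using s q by (simp only: less_root_nat_iff)
      also have "\<dots> \<le> 3 * card {p \<in> perms n. ?k \<le> card (fixpts n p)}"
        unfolding G_def using assms S False
        by (intro card_perms_avg_hits_ge_le) (auto simp: S_def simp flip: sum_divide_distrib)
      also have "\<dots> = 3 * card {p \<in> perms n. card (fixpts n p) powr (1 / q) > s}"
        using s q by (simp only: less_root_nat_iff)
      finally show "card {p \<in> perms n. K p powr (1 / q) > s}
        \<le> 3 * card {p \<in> perms n. card (fixpts n p) powr (1 / q) > s}" .
    qed auto
  qed
  have pointwise: "?M p powr (1 / q) \<le> S powr (1 / q) * (K p powr (1 / q) + 1)" for p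
  proof -
    have "G p \<le> real (K p) + 1"
      unfolding K_def by linarith
    then have "G p powr (1 / q) \<le> (real (K p) + 1) powr (1 / q)"
      using G q by (intro powr_mono2) auto
    also have "\<dots> \<le> K p powr (1 / q) + 1 powr (1 / q)"
      using q by (intro powr_add_le_add_powr) auto
    finally show ?thesis
      using S G q by (simp add: SG powr_mult mult_left_mono)
  qed
  have "N (step (perms n) l (\<lambda>p. ?M p powr (1 / q)))
      \<le> N (step (perms n) l (\<lambda>p. S powr (1 / q) * (K p powr (1 / q) + 1)))"
    using pointwise by (intro N_step_mono[OF stp]) (auto intro: order_trans[OF _ abs_ge_self])
  also have "\<dots> = S powr (1 / q) * N (step (perms n) l (\<lambda>p. K p powr (1 / q) + 1))"
    by (simp add: N_step_cmult[OF stp])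
  also have "\<dots> \<le> S powr (1 / q) * (N (step (perms n) l (\<lambda>p. K p powr (1 / q))) + N (step (perms n) l (\<lambda>_. 1)))"
    by (intro mult_left_mono N_step_add_le[OF stp]) auto
  also have "\<dots> \<le> S powr (1 / q) * (3 * N (step (perms n) l (\<lambda>p. card (fixpts n p) powr (1 / q))) + 1)"
    using domK N_step_bounded[OF stp, of 1 "\<lambda>_. 1"] by (intro mult_left_mono add_mono) auto
  finally show ?thesis
    by (simp add: S_def)
qed

end

text \<open>The entry \<open>w (r * n)\<close> is the maximum of block \<open>r\<close>. For
  \<open>r \<ge> 2\<close> it is at most the average of block \<open>r - 1\<close>, and these
  averages add up to at most the tail divided by \<open>n\<close>. For \<open>r = 1\<close> the
  preceding block is outside the tail, so \<open>w (n - 1)\<close> is spent instead.\<close>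

lemma sum_block_maxima_le:
  fixes w :: "nat \<Rightarrow> real"
  assumes mono: "\<And>i j. i \<le> j \<Longrightarrow> j < n^2 \<Longrightarrow> w j \<le> w i" and nonneg: "\<And>k. k < n^2 \<Longrightarrow> w k \<ge> 0"
    and n: "n \<ge> 1"
  shows "(\<Sum>r = 1..<n. w (r * n)) \<le> w (n - 1) + 1 / n * (\<Sum>k = n..<n^2. w k)"
proof -
  have pos: "(\<Sum>j<n. w (r * n + j)) \<ge> 0" if "r < n" for r
    using block_index_less[OF that] nonneg by (intro sum_nonneg) auto
  have "(\<Sum>k<n. w k) + (\<Sum>k = n..<n^2. w k) = (\<Sum>k<n * n. w k)"
    using n by (simp add: sum.atLeastLessThan_concat power2_eq_square flip: atLeast0LessThan)
  also have "\<dots> = (\<Sum>r = 0..<n. \<Sum>j<n. w (r * n + j))"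
    by (simp add: sum_blocks atLeast0LessThan)
  also have "\<dots> = (\<Sum>k<n. w k) + (\<Sum>r = 1..<n. \<Sum>j<n. w (r * n + j))"
    using n by (subst sum.atLeast_Suc_lessThan) auto
  finally have tail: "(\<Sum>k = n..<n^2. w k) = (\<Sum>r = 1..<n. \<Sum>j<n. w (r * n + j))"
    by simp
  show ?thesis
  proof (cases "n = 1")
    case True
    then show ?thesis
      using nonneg by simp
  next
    case False
    then have n2: "n \<ge> 2"
      using n by simp
    have "w (Suc r * n) \<le> 1 / n * (\<Sum>j<n. w (r * n + j))" if "Suc r < n" for r
    proof -
      have lt: "Suc r * n < n^2"
        using block_index_less[of "Suc r" n 0] that n by simp
      have "(\<Sum>j<n. w (Suc r * n)) \<le> (\<Sum>j<n. w (r * n + j))"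
        using lt by (intro sum_mono mono) auto
      then show ?thesis
        using n by (simp add: field_simps)
    qed
    then have "(\<Sum>r = 1..<n - 1. w (Suc r * n)) \<le> (\<Sum>r = 1..<n - 1. 1 / n * (\<Sum>j<n. w (r * n + j)))"
      by (intro sum_mono) auto
    also have "\<dots> \<le> (\<Sum>r = 1..<n. 1 / n * (\<Sum>j<n. w (r * n + j)))"
      using pos by (intro sum_mono2) auto
    also have "\<dots> = 1 / n * (\<Sum>k = n..<n^2. w k)"
      by (simp add: tail sum_distrib_left)
    finally have "(\<Sum>r = 1..<n - 1. w (Suc r * n)) \<le> 1 / n * (\<Sum>k = n..<n^2. w k)" .
    moreover have "(\<Sum>r = 1..<n. w (r * n)) = w n + (\<Sum>r = 1..<n - 1. w (Suc r * n))"
    proof -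
      have "(\<Sum>r = Suc 1..<Suc (n - 1). w (r * n)) = (\<Sum>r = 1..<n - 1. w (Suc r * n))"
        by (rule sum.shift_bounds_Suc_ivl)
      then show ?thesis
        using n2 by (subst sum.atLeast_Suc_lessThan) auto
    qed
    moreover have "w n \<le> w (n - 1)"
      using n2 by (intro mono) (auto simp: power2_eq_square)
    ultimately show ?thesis
      by linarith
  qed
qed

section \<open>Splitting a matrix into its \<open>n\<close> largest entries and the rest\<close>

theorem theorem7:
  fixes n :: nat and C q :: real
    and E :: "(real \<Rightarrow> real) set" and N :: "(real \<Rightarrow> real) \<Rightarrow> real"
    and l :: "(nat \<Rightarrow> nat) \<Rightarrow> nat"
  assumes "n \<ge> 1" and "C > 1" and "q > 1"
    and "ri_space E N"
    and "bij_betw l {p. p permutes {..<n}} {1..fact n}"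
    and "\<And>y :: real mat. y \<in> carrier_mat n n \<Longrightarrow> diagonal_mat y \<Longrightarrow>
           N (T_op l q y) \<le> C * N (U_op y)"
  shows "\<forall>x :: real mat. x \<in> carrier_mat n n \<longrightarrow>
           N (T_op l q x) \<le> 7 * C * (N (U_op x) +
             ((1 / real n) * (\<Sum>k = n + 1..n ^ 2. mat_rearr x k powr q)) powr (1 / q))"
proof (intro allI impI)
  fix x :: "real mat" assume x: "x \<in> carrier_mat n n"
  note n = assms(1) and C = assms(2) and q = assms(3) and ri = assms(4)
  have stp: "finite (perms n)" "bij_betw l (perms n) {1..card (perms n)}" "ri_space E N"
    using assms(4,5) by simp_all
  obtain e where e: "bij_betw e {..<n^2} ({..<n} \<times> {..<n})"
    and ex: "\<And>k. k < n^2 \<Longrightarrow> \<bar>x $$ e k\<bar> = mat_rearr x (Suc k)"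
    and mono: "\<And>i j. i \<le> j \<Longrightarrow> j < n^2 \<Longrightarrow> mat_rearr x (Suc j) \<le> mat_rearr x (Suc i)"
    using mat_rearr_enumeration[OF x] by blast
  \<comment> \<open>\<open>v\<close> lists the rearrangement from index 0, and \<open>w\<close> its
    \<open>q\<close>-th powers. \<open>A\<close> collects the hits among the \<open>n\<close>
    largest entries, \<open>B\<close> those in the later blocks, and \<open>S\<close> is the sum of
    the later block maxima.\<close>
  define v where "v = (\<lambda>k. mat_rearr x (Suc k))"
  define w where "w = (\<lambda>k. v k powr q)"
  define c where "c = (\<lambda>r j. e (r * n + j))"
  define A where "A = (\<lambda>p. \<Sum>j\<in>hits n (c 0) p. w j)"
  define B where "B = (\<lambda>p. \<Sum>r = 1..<n. \<Sum>j\<in>hits n (c r) p. w (r * n + j))"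
  define S where "S = (\<Sum>r = 1..<n. w (r * n))"
  define M where "M = 1 / real n * (\<Sum>k = n + 1..n ^ 2. mat_rearr x k powr q)"
  have nn: "n \<le> n^2"
    by (simp add: power2_eq_square)
  have v0: "v k \<ge> 0" if "k < n^2" for k
    using ex[OF that] by (simp add: v_def flip: ex)
  have w0: "w k \<ge> 0" for k
    by (simp add: w_def)
  have wmono: "w j \<le> w i" if "i \<le> j" "j < n^2" for i j
    using mono[OF that] v0[of j] that q by (auto simp: w_def v_def intro!: powr_mono2)
  have brd: "board n (c r)" if "r < n" for r
    using board_block[OF e that] by (simp add: c_def)
  have M0: "M \<ge> 0"
    by (simp add: M_def sum_nonneg)

  have Tx: "T_op l q x = step (perms n) l (\<lambda>p. (A p + B p) powr (1 / q))"
    unfolding T_op_eq_step[OF x]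
  proof (rule step_cong)
    fix p assume "p \<in> perms n"
    then have "(\<Sum>i<n. \<bar>x $$ (i, p i)\<bar> powr q)
        = (\<Sum>r<n. \<Sum>j\<in>hits n (c r) p. \<bar>x $$ e (r * n + j)\<bar> powr q)"
      unfolding c_def using sum_perm_entries[OF e, of p "\<lambda>k. \<bar>x $$ k\<bar> powr q"] by simp
    also have "\<dots> = (\<Sum>r<n. \<Sum>j\<in>hits n (c r) p. w (r * n + j))"
      using block_index_less ex by (intro sum.cong) (auto simp: w_def v_def hits_def)
    also have "\<dots> = A p + B p"
      unfolding atLeast0LessThan[symmetric] A_def B_def
      using n by (subst sum.atLeast_Suc_lessThan) auto
    finally show "(\<Sum>i<n. \<bar>x $$ (i, p i)\<bar> powr q) powr (1 / q) = (A p + B p) powr (1 / q)"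
      by simp
  qed
  have AB0: "A p \<ge> 0" "B p \<ge> 0" for p
    by (auto simp: A_def B_def w0 intro!: sum_nonneg)
  have "N (T_op l q x) \<le> N (step (perms n) l (\<lambda>p. A p powr (1 / q) + B p powr (1 / q)))"
    unfolding Tx using q AB0
    by (intro N_step_mono[OF stp]) (auto intro!: powr_add_le_add_powr)
  also have "\<dots> \<le> N (step (perms n) l (\<lambda>p. A p powr (1 / q))) + N (step (perms n) l (\<lambda>p. B p powr (1 / q)))"
    by (rule N_step_add_le[OF stp])
  also have "N (step (perms n) l (\<lambda>p. A p powr (1 / q))) \<le> 3 * (C * N (U_op x))"
  proof -
    have v: "v j \<ge> 0" if "j < n" for j
      using v0 that nn by simp
    have "T_op l q (diag_of n v) = step (perms n) l (\<lambda>p. (\<Sum>j\<in>fixpts n p. w j) powr (1 / q))"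
      unfolding w_def using v by (rule T_op_diag_of)
    then have "N (step (perms n) l (\<lambda>p. A p powr (1 / q))) \<le> 3 * N (T_op l q (diag_of n v))"
      unfolding A_def
      using N_step_hits_le[OF q ri assms(5) brd[of 0], of w] n w0 by (simp add: w_def)
    also have "\<dots> \<le> 3 * (C * N (U_op (diag_of n v)))"
      using assms(6)[OF diag_of_carrier diagonal_diag_of] by simp
    \<comment> \<open>\<open>U_op\<close> sees only the \<open>n\<close> largest entries, and these
      agree for the two matrices.\<close>
    also have "U_op (diag_of n v) = U_op x"
    proof (rule U_op_cong[OF diag_of_carrier x])
      fix k assume k: "1 \<le> k" "k \<le> n"
      have "mat_rearr (diag_of n v) k = v (k - 1)"
        using v mono nn k by (intro mat_rearr_diag_of) (auto simp: v_def)
      then show "mat_rearr (diag_of n v) k = mat_rearr x k"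
        using k by (simp add: v_def)
    qed
    finally show ?thesis .
  qed
  also have "N (step (perms n) l (\<lambda>p. B p powr (1 / q))) \<le> 4 * C * (N (U_op x) + M powr (1 / q))"
  proof -
    let ?F = "step (perms n) l (\<lambda>p. real (card (fixpts n p)) powr (1 / q))"
    have B_le: "B p \<le> (\<Sum>r = 1..<n. w (r * n) * card (hits n (c r) p))" for p
      unfolding B_def
    proof (rule sum_mono)
      fix r assume "r \<in> {1..<n}"
      then have "(\<Sum>j\<in>hits n (c r) p. w (r * n + j)) \<le> (\<Sum>j\<in>hits n (c r) p. w (r * n))"
        using block_index_less by (intro sum_mono wmono) (auto simp: hits_def)
      then show "(\<Sum>j\<in>hits n (c r) p. w (r * n + j)) \<le> w (r * n) * card (hits n (c r) p)"
        by (simp add: mult.commute)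
    qed
    \<comment> \<open>Apply the hypothesis to the identity matrix: its \<open>T_op\<close> is
      \<open>?F\<close>, and its \<open>U_op\<close> is almost everywhere 1.\<close>
    have F: "N ?F \<le> C"
    proof -
      have one: "mat_rearr (diag_of n (\<lambda>_. 1)) k = 1" if "1 \<le> k" "k \<le> n" for k
        using that by (subst mat_rearr_diag_of) auto
      have "N ?F = N (T_op l q (diag_of n (\<lambda>_. 1)))"
        by (subst T_op_diag_of) auto
      also have "\<dots> \<le> C * N (U_op (diag_of n (\<lambda>_. 1)))"
        by (rule assms(6)[OF diag_of_carrier diagonal_diag_of])
      also have "\<dots> \<le> C * 1"
        using N_U_op_le[OF ri diag_of_carrier n, of "\<lambda>_. 1" 1] one C by (intro mult_left_mono) auto
      finally show ?thesis
        by simp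
    qed
    \<comment> \<open>The function \<open>U_op x\<close> is almost everywhere at least its smallest
      step \<open>v (n - 1)\<close>, and constants have their modulus as norm.\<close>
    have "v (n - 1) \<le> N (U_op x)"
    proof (rule le_N_U_op[OF ri x n])
      show "v (n - 1) \<ge> 0"
        using v0 n nn by simp
      fix k assume k: "1 \<le> k" "k \<le> n"
      then have "mat_rearr x (Suc (n - 1)) \<le> mat_rearr x (Suc (k - 1))"
        using nn n by (intro mono) linarith+
      then show "v (n - 1) \<le> \<bar>mat_rearr x k\<bar>"
        using k by (simp add: v_def)
    qed
    moreover have "S \<le> w (n - 1) + M"
    proof -
      have "(\<Sum>k = n + 1..n^2. mat_rearr x k powr q) = (\<Sum>k = n..<n^2. w k)"
        by (rule sum.reindex_bij_witness[of _ Suc "\<lambda>k. k - 1"]) (auto simp: w_def v_def)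
      then show ?thesis
        unfolding S_def M_def using sum_block_maxima_le[of n w] wmono w0 n by simp
    qed
    then have "S powr (1 / q) \<le> (w (n - 1) + M) powr (1 / q)"
      using q w0 by (intro powr_mono2) (auto simp: S_def sum_nonneg)
    moreover have "\<dots> \<le> w (n - 1) powr (1 / q) + M powr (1 / q)"
      using q w0 M0 by (intro powr_add_le_add_powr) auto
    moreover have "w (n - 1) powr (1 / q) = v (n - 1)"
      using q v0[of "n - 1"] n nn by (simp add: w_def powr_powr)
    ultimately have S_le: "S powr (1 / q) \<le> N (U_op x) + M powr (1 / q)"
      by linarith
    have "N (step (perms n) l (\<lambda>p. B p powr (1 / q)))
        \<le> N (step (perms n) l (\<lambda>p. (\<Sum>r = 1..<n. w (r * n) * card (hits n (c r) p)) powr (1 / q)))"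
      using q AB0 B_le by (intro N_step_mono[OF stp]) (auto intro!: powr_mono2)
    also have "\<dots> \<le> S powr (1 / q) * (3 * N ?F + 1)"
      unfolding S_def using brd w0 by (intro N_step_weighted_hits_le[OF q ri assms(5)]) auto
    \<comment> \<open>Here \<open>C > 1\<close> absorbs the rounding term:
      \<open>3 * C + 1 \<le> 4 * C\<close>.\<close>
    also have "\<dots> \<le> S powr (1 / q) * (4 * C)"
      using F C by (intro mult_left_mono) auto
    also have "\<dots> \<le> (N (U_op x) + M powr (1 / q)) * (4 * C)"
      using S_le C by (intro mult_right_mono) auto
    finally show ?thesis
      by (simp add: mult_ac)
  qed
  also have "3 * (C * N (U_op x)) + 4 * C * (N (U_op x) + M powr (1 / q))
      \<le> 7 * C * (N (U_op x) + M powr (1 / q))"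
    using C by (simp add: algebra_simps)
  finally show "N (T_op l q x) \<le> 7 * C * (N (U_op x) +
      ((1 / real n) * (\<Sum>k = n + 1..n ^ 2. mat_rearr x k powr q)) powr (1 / q))"
    by (simp add: M_def)
qed

end
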